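(* Let $c=h/k\in(0,1)$ with $h,k$ coprime positive integers, and let $O=O_c$ be the set of positive irrational numbers $\alpha$ for which the sequence $(D_n(\alpha,c))_{n\ge 0}$ is one-side bounded. Then: (1) $O$ is dense in $\mathbb{R}^+$. (2) $O$ is of the first category (a countable union of nowhere dense sets). (3) The Hausdorff dimension of $O$ satisfies $0<\dim_H(O)<1$. Hence $O$ is uncountable, of Lebesgue measure $0$ and totally disconnected.
   Context: For $n\ge 0$, $D_n(\alpha,c)=\sum_{j=1}^n 1_{[0,c)}(\{j\alpha\})-cn$, where $\{\cdot\}$ is the fractional part. The sequence is called one-side bounded if it is bounded from above or bounded from below. $\mathbb{R}^+$ denotes the set of positive real numbers. *)

theory Defs
  imports "HOL-Analysis.Analysis"
begin

definition discrepancy :: "real \<Rightarrow> real \<Rightarrow> nat \<Rightarrow> real" where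
  "discrepancy \<alpha> c n =
     (\<Sum>j=1..n. indicat_real {0..<c} (frac (real j * \<alpha>))) - c * real n"

definition one_side_bounded :: "(nat \<Rightarrow> real) \<Rightarrow> bool" where
  "one_side_bounded X \<longleftrightarrow> bdd_above (range X) \<or> bdd_below (range X)"

definition one_side_bounded_set :: "real \<Rightarrow> real set" where
  "one_side_bounded_set c =
     {\<alpha>. \<alpha> > 0 \<and> \<alpha> \<notin> \<rat> \<and> one_side_bounded (discrepancy \<alpha> c)}"

definition nowhere_dense :: "'a::topological_space set \<Rightarrow> bool" where
  "nowhere_dense S \<longleftrightarrow> interior (closure S) = {}"

definition first_category :: "'a::topological_space set \<Rightarrow> bool" where
  "first_category S \<longleftrightarrow>
     (\<exists>F :: nat \<Rightarrow> 'a set. (\<forall>i. nowhere_dense (F i)) \<and> S = (\<Union>i. F i))"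

definition totally_disconnected :: "'a::topological_space set \<Rightarrow> bool" where
  "totally_disconnected S \<longleftrightarrow>
     (\<forall>C. C \<subseteq> S \<and> connected C \<longrightarrow> (\<forall>x\<in>C. \<forall>y\<in>C. x = y))"

(* The summand (diam U)^s of the Hausdorff measure, with the usual conventions that the
   empty set contributes 0 and that 0^0 = 1 (whereas 0 powr 0 = 0). *)
definition hausdorff_gauge :: "real \<Rightarrow> 'a::metric_space set \<Rightarrow> ennreal" where
  "hausdorff_gauge s U =
     (if U = {} then 0 else if s = 0 then 1 else ennreal (diameter U powr s))"

(* Boundedness is required because diameter is real-valued and hence unspecified on
   unbounded sets. Finite covers are included, as the U i may be empty. *)
definition hausdorff_premeasure :: "real \<Rightarrow> real \<Rightarrow> 'a::metric_space set \<Rightarrow> ennreal" where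
  "hausdorff_premeasure s \<delta> A =
     (INF U \<in> {U :: nat \<Rightarrow> 'a set.
                 A \<subseteq> (\<Union>i. U i) \<and> (\<forall>i. bounded (U i) \<and> diameter (U i) \<le> \<delta>)}.
        (\<Sum>i. hausdorff_gauge s (U i)))"

definition hausdorff_measure :: "real \<Rightarrow> 'a::metric_space set \<Rightarrow> ennreal" where
  "hausdorff_measure s A = (SUP \<delta>\<in>{0<..}. hausdorff_premeasure s \<delta> A)"

(* Valued in ennreal so that the infimum is infinite if no s qualifies. *)
definition hausdorff_dim :: "'a::metric_space set \<Rightarrow> ennreal" where
  "hausdorff_dim A = (INF s \<in> {s. s \<ge> 0 \<and> hausdorff_measure s A = 0}. ennreal s)"

end

theory Submission
  imports Defs
begin

text \<open>
  If \<open>p/q\<close> is an upper approximation of \<open>\<alpha>\<close> with \<open>q (p - q \<alpha>) < 1/k\<close> and \<open>k\<close> does not divide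
  \<open>q\<close>, then \<open>D\<^sub>q \<le> -1/k\<close>, and sums of sparse such denominators show that infinitely many of them
  make the sequence unbounded from below; by \<open>D\<^sub>n(-\<alpha>, 1 - c) = -D\<^sub>n(\<alpha>, c)\<close> the same holds
  above with lower approximations. Hence \<open>O\<close> lies in a countable union of closed sets of
  numbers that avoid a neighbourhood of fixed relative size to one side of most rationals. Two steps
  of the continued fraction algorithm shrink the cylinders meeting such a set by a factor
  \<open>\<theta> < 1\<close> in total \<open>t\<close>-dimensional size, for some \<open>t < 1\<close>, so the set is a null set for the
  \<open>t\<close>-dimensional Hausdorff measure, hence Lebesgue null and nowhere dense.

  Conversely, the discrepancy of \<open>1/(k a + 1/\<gamma>)\<close> at suitable indices is that of \<open>\<gamma>\<close> at smaller
  ones, so it is nonnegative if all partial quotients are multiples of \<open>k\<close>. The partial quotients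
  \<open>k\<close> and \<open>2 k\<close> give a Cantor set of positive dimension, and images of one of its points under
  Moebius maps congruent to the identity modulo \<open>k\<close> in the lower row are dense.
\<close>

subsection \<open>Hausdorff premeasures\<close>

text \<open>The deficit -1/k comes from rounding: after the shift at most floor(c q) of the
  \<open>q\<close> points are counted, and this is a fixed amount below \<open>c q\<close> exactly
  when \<open>c q\<close> is not an integer, that is, when \<open>k\<close> does not divide
  \<open>q\<close>. The resulting restriction concerns upper convergents only, and convergents
  alternate sides, so a single continued fraction step need not lose anything; this is why two steps
  form a block. Inside a block, determinant 1 prevents \<open>k\<close> from dividing the upper
  denominator for all small quotients, which makes the loss uniform over all cells. The loss is
  first seen at exponent 1. Every cell has infinitely many children, but their proportions decay
  like 1/a^2, so the sums still converge for exponents above 1/2 and the loss survives at some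
  exponent below 1. Infinite continued fractions are avoided on both sides: cells are given by two
  integer pairs and the Euclidean algorithm, and prescribed partial quotients by sets that are
  closed under taking tails.\<close>

lemma hausdorff_premeasure_le_cover:
  assumes "A \<subseteq> (\<Union>i. U i)" "\<And>i. bounded (U i)" "\<And>i. diameter (U i) \<le> \<delta>"
  shows "hausdorff_premeasure s \<delta> A \<le> (\<Sum>i. hausdorff_gauge s (U i))"
  unfolding hausdorff_premeasure_def by (rule INF_lower) (use assms in auto)

lemma hausdorff_premeasure_mono:
  assumes "A \<subseteq> B"
  shows "hausdorff_premeasure s \<delta> A \<le> hausdorff_premeasure s \<delta> B"
  unfolding hausdorff_premeasure_def by (rule INF_superset_mono) (use assms in auto)

lemma hausdorff_premeasure_approx:
  assumes "hausdorff_premeasure s \<delta> A \<noteq> \<infinity>" "e > 0"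
  obtains U where "A \<subseteq> (\<Union>i. U i)" "\<And>i. bounded (U i)" "\<And>i. diameter (U i) \<le> \<delta>"
    "(\<Sum>i. hausdorff_gauge s (U i)) < hausdorff_premeasure s \<delta> A + ennreal e"
  using INF_approx_ennreal[OF assms(2) hausdorff_premeasure_def assms(1)] that by blast

lemma hausdorff_premeasure_le_single:
  assumes "bounded A" "diameter A \<le> d" "d \<le> \<delta>" "0 < s"
  shows "hausdorff_premeasure s \<delta> A \<le> ennreal (d powr s)"
proof -
  define U where "U = (\<lambda>i::nat. if i = 0 then A else {})"
  have d: "0 \<le> diameter A" using assms diameter_ge_0 by blast
  have "hausdorff_premeasure s \<delta> A \<le> (\<Sum>i. hausdorff_gauge s (U i))"
    by (rule hausdorff_premeasure_le_cover) (use assms d in \<open>auto simp: U_def\<close>)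
  also have "\<dots> = (\<Sum>i\<in>{0}. hausdorff_gauge s (U i))"
    by (rule suminf_finite) (auto simp: U_def hausdorff_gauge_def)
  also have "\<dots> \<le> ennreal (d powr s)"
    using assms d by (auto simp: U_def hausdorff_gauge_def intro!: ennreal_leI powr_mono2)
  finally show ?thesis .
qed

lemma hausdorff_premeasure_empty [simp]: "0 \<le> \<delta> \<Longrightarrow> hausdorff_premeasure s \<delta> {} = 0"
  using hausdorff_premeasure_le_cover[of "{}" "\<lambda>_. {}" \<delta> s] by (simp add: hausdorff_gauge_def)

lemma hausdorff_premeasure_UN_le:
  fixes A :: "nat \<Rightarrow> 'a::metric_space set"
  shows "hausdorff_premeasure s \<delta> (\<Union>i. A i) \<le> (\<Sum>i. hausdorff_premeasure s \<delta> (A i))"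
proof (rule ennreal_le_epsilon)
  fix e :: real assume fin: "(\<Sum>i. hausdorff_premeasure s \<delta> (A i)) < top" and e: "0 < e"
  let ?pm = "\<lambda>i. hausdorff_premeasure s \<delta> (A i)"
  have "\<exists>U. A i \<subseteq> (\<Union>j. U j) \<and> (\<forall>j. bounded (U j) \<and> diameter (U j) \<le> \<delta>)
      \<and> (\<Sum>j. hausdorff_gauge s (U j)) < ?pm i + ennreal (e * (1/2) ^ Suc i)" for i
  proof -
    have "?pm i < top" using ennreal_suminf_lessD[OF fin] .
    then show ?thesis
      using hausdorff_premeasure_approx[of s \<delta> "A i" "e * (1/2) ^ Suc i"] e
      by (smt (verit, best) infinity_ennreal_def less_irrefl mult_pos_pos zero_less_divide_1_iff zero_less_power)
  qed
  then obtain U where U: "\<And>i. A i \<subseteq> (\<Union>j. U i j)" "\<And>i j. bounded (U i j)"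
      "\<And>i j. diameter (U i j) \<le> \<delta>"
      "\<And>i. (\<Sum>j. hausdorff_gauge s (U i j)) < ?pm i + ennreal (e * (1/2) ^ Suc i)"
    by metis
  define V where "V = (\<lambda>n. case prod_decode n of (i, j) \<Rightarrow> U i j)"
  have cov: "(\<Union>i. A i) \<subseteq> (\<Union>n. V n)"
  proof clarify
    fix x i assume "x \<in> A i"
    then obtain j where "x \<in> U i j" using U(1) by blast
    then have "x \<in> V (prod_encode (i, j))" by (simp add: V_def)
    then show "x \<in> (\<Union>n. V n)" by blast
  qed
  have "hausdorff_premeasure s \<delta> (\<Union>i. A i) \<le> (\<Sum>n. hausdorff_gauge s (V n))"
    by (rule hausdorff_premeasure_le_cover[OF cov]) (auto simp: V_def U split: prod.splits)
  also have "\<dots> = (\<Sum>n. (\<lambda>(i, j). hausdorff_gauge s (U i j)) (prod_decode n))"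
    by (intro suminf_cong) (auto simp: V_def split: prod.splits)
  also have "\<dots> = (\<Sum>i. \<Sum>j. hausdorff_gauge s (U i j))"
    by (rule suminf_ennreal_2dimen) auto
  also have "\<dots> \<le> (\<Sum>i. ?pm i + ennreal (e * (1/2) ^ Suc i))"
    using U(4) by (intro suminf_le) (auto intro: less_imp_le)
  also have "\<dots> = (\<Sum>i. ?pm i) + (\<Sum>i. ennreal (e * (1/2) ^ Suc i))"
    by (subst suminf_add) auto
  also have "(\<Sum>i. ennreal (e * (1/2) ^ Suc i)) = ennreal e"
    using e sums_mult[OF power_half_series, of e] by (intro suminf_ennreal_eq) auto
  finally show "hausdorff_premeasure s \<delta> (\<Union>i. A i) \<le> (\<Sum>i. ?pm i) + ennreal e" .
qed

lemma hausdorff_premeasure_null_UN: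
  assumes "countable I" "\<And>i. i \<in> I \<Longrightarrow> hausdorff_premeasure s \<delta> (A i) = 0" "0 \<le> \<delta>"
  shows "hausdorff_premeasure s \<delta> (\<Union>i\<in>I. A i) = 0"
proof (cases "I = {}")
  case False
  have "(\<Union>i\<in>I. A i) = (\<Union>n. A (from_nat_into I n))"
    using range_from_nat_into[OF False assms(1)] by (metis image_image)
  moreover have "(\<Sum>n. hausdorff_premeasure s \<delta> (A (from_nat_into I n))) = 0"
    using assms(2) from_nat_into[OF False] by simp
  ultimately show ?thesis
    using hausdorff_premeasure_UN_le[of s \<delta> "\<lambda>n. A (from_nat_into I n)"] by simp
qed (use assms in simp)

lemma hausdorff_premeasure_null_Un:
  assumes "hausdorff_premeasure s \<delta> A = 0" "hausdorff_premeasure s \<delta> B = 0" "0 \<le> \<delta>"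
  shows "hausdorff_premeasure s \<delta> (A \<union> B) = 0"
  using hausdorff_premeasure_null_UN[of "UNIV :: bool set" s \<delta> "\<lambda>b. if b then A else B"] assms
  by (simp add: UNIV_bool Un_commute split: if_splits)

lemma hausdorff_premeasure_null_countable:
  fixes A :: "'a::metric_space set"
  assumes "countable A" "0 < s" "0 \<le> \<delta>"
  shows "hausdorff_premeasure s \<delta> A = 0"
proof -
  have "hausdorff_premeasure s \<delta> {x} = 0" for x :: 'a
    using hausdorff_premeasure_le_single[of "{x}" 0 \<delta> s] assms by simp
  then show ?thesis
    using hausdorff_premeasure_null_UN[OF assms(1), of s \<delta> "\<lambda>x. {x}"] assms by simp
qed

lemma hausdorff_premeasure_null_uminus:
  fixes A :: "real set"
  assumes "hausdorff_premeasure s \<delta> A = 0" and s: "0 \<le> s"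
  shows "hausdorff_premeasure s \<delta> (uminus ` A) = 0"
proof -
  have "hausdorff_premeasure s \<delta> (uminus ` A) \<le> 0"
  proof (rule ennreal_le_epsilon)
    fix e :: real assume e: "0 < e"
    obtain U where U: "A \<subseteq> (\<Union>i. U i)" "\<And>i. bounded (U i)" "\<And>i. diameter (U i) \<le> \<delta>"
      "(\<Sum>i. hausdorff_gauge s (U i)) < 0 + ennreal e"
      using hausdorff_premeasure_approx[of s \<delta> A e] assms e by auto
    have d: "diameter (uminus ` U i) \<le> diameter (U i)" for i
    proof (cases "U i = {}")
      case False
      then show ?thesis
      proof (intro diameter_le)
        fix x y assume "x \<in> uminus ` U i" "y \<in> uminus ` U i"
        then obtain a b where "a \<in> U i" "b \<in> U i" "x = - a" "y = - b" by auto
        then show "norm (x - y) \<le> diameter (U i)"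
          using diameter_bounded_bound[OF U(2)[of i], of a b] by (simp add: dist_real_def)
      qed simp
    qed simp
    have b: "bounded (uminus ` U i)" for i
      using U(2)[of i] bounded_uminus by auto
    have g: "hausdorff_gauge s (uminus ` U i) \<le> hausdorff_gauge s (U i)" for i
      unfolding hausdorff_gauge_def
      using d[of i] diameter_ge_0[OF b[of i]] s by (auto intro!: ennreal_leI powr_mono2)
    have "uminus ` A \<subseteq> (\<Union>i. uminus ` U i)"
      using image_mono[OF U(1), of uminus] by (simp add: image_UN)
    then have "hausdorff_premeasure s \<delta> (uminus ` A) \<le> (\<Sum>i. hausdorff_gauge s (uminus ` U i))"
      using hausdorff_premeasure_le_cover b order_trans[OF d U(3)] by metis
    also have "\<dots> \<le> (\<Sum>i. hausdorff_gauge s (U i))"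
      by (intro suminf_le g) auto
    finally show "hausdorff_premeasure s \<delta> (uminus ` A) \<le> 0 + ennreal e" using U(4) by simp
  qed
  then show ?thesis by simp
qed

text \<open>A cover whose sum is below \<open>\<delta> powr s\<close> has all diameters at most
  \<delta>, since each single term is below that bound. So a null premeasure at scale 1 is null at
  every scale, and all estimates can be made at scale 1.\<close>

lemma hausdorff_measure_eq_0:
  assumes "hausdorff_premeasure s 1 A = 0" "0 < s"
  shows "hausdorff_measure s A = 0"
proof -
  have "hausdorff_premeasure s \<delta> A \<le> 0" if \<delta>: "0 < \<delta>" for \<delta> :: real
  proof (rule ennreal_le_epsilon)
    fix e :: real assume e: "0 < e"
    define e' where "e' = min e (\<delta> powr s)"
    have e': "0 < e'" using e \<delta> by (simp add: e'_def)
    obtain U where U: "A \<subseteq> (\<Union>i. U i)" "\<And>i. bounded (U i)" "\<And>i. diameter (U i) \<le> 1"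
      "(\<Sum>i. hausdorff_gauge s (U i)) < 0 + ennreal e'"
      using hausdorff_premeasure_approx[of s 1 A e'] assms e' by auto
    have "diameter (U i) \<le> \<delta>" for i
    proof (cases "U i = {}")
      case False
      have "hausdorff_gauge s (U i) < ennreal e'" using ennreal_suminf_lessD[OF U(4)] by simp
      then have "diameter (U i) powr s < e'"
        using False assms(2) by (simp add: hausdorff_gauge_def ennreal_less_iff)
      then have "diameter (U i) powr s < \<delta> powr s" by (simp add: e'_def)
      then show ?thesis using assms(2) \<delta> by (smt (verit) powr_mono2)
    qed (use \<delta> in simp)
    then have "hausdorff_premeasure s \<delta> A \<le> (\<Sum>i. hausdorff_gauge s (U i))"
      by (intro hausdorff_premeasure_le_cover U(1,2))
    also have "\<dots> \<le> ennreal e'" using U(4) by simp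
    also have "\<dots> \<le> ennreal e" by (simp add: e'_def ennreal_leI)
    finally show "hausdorff_premeasure s \<delta> A \<le> 0 + ennreal e" by simp
  qed
  then have "hausdorff_measure s A \<le> 0"
    unfolding hausdorff_measure_def by (intro SUP_least) simp
  then show ?thesis by simp
qed

section \<open>Comparison with Lebesgue measure and with countability\<close>

text \<open>A nonempty set of diameter \<open>d\<close> lies in the closed interval of radius
  \<open>d\<close> about any of its points, whose length \<open>2 * d\<close> is at most
  \<open>2 * d powr s\<close> because \<open>d \<le> 1\<close> and \<open>s \<le> 1\<close>.\<close>

lemma borel_cover_diameter:
  fixes U :: "nat \<Rightarrow> real set"
  assumes "\<And>i. bounded (U i)" "\<And>i. diameter (U i) \<le> 1" "s \<le> 1"
  obtains T where "T \<in> sets borel" "(\<Union>i. U i) \<subseteq> T"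
    "emeasure lborel T \<le> 2 * (\<Sum>i. hausdorff_gauge s (U i))"
proof
  define V where "V = (\<lambda>i. if U i = {} then {} else cball (SOME x. x \<in> U i) (diameter (U i)))"
  have "U i \<subseteq> V i" for i
  proof
    fix y assume y: "y \<in> U i"
    then have "(SOME x. x \<in> U i) \<in> U i" by (rule someI)
    then show "y \<in> V i" using y diameter_bounded_bound[OF assms(1)] by (auto simp: V_def)
  qed
  then show "(\<Union>i. U i) \<subseteq> (\<Union>i. V i)" by blast
  have V: "V i \<in> sets borel" for i by (simp add: V_def)
  then show "(\<Union>i. V i) \<in> sets borel" by blast
  have "emeasure lborel (V i) \<le> 2 * hausdorff_gauge s (U i)" for i
  proof (cases "U i = {}")
    case False
    have d: "0 \<le> diameter (U i)" using assms diameter_ge_0 by blast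
    have "emeasure lborel (V i) = ennreal (2 * diameter (U i))"
      using False d by (simp add: V_def cball_eq_atLeastAtMost)
    also have "\<dots> = 2 * ennreal (diameter (U i))" using d by (simp add: ennreal_mult)
    also have "ennreal (diameter (U i)) \<le> hausdorff_gauge s (U i)"
    proof (cases "diameter (U i) = 0")
      case nz: False
      have "diameter (U i) powr 1 \<le> diameter (U i) powr s"
        using d nz assms by (intro powr_mono') auto
      then show ?thesis using False d nz assms(2)[of i]
        by (auto simp: hausdorff_gauge_def intro!: ennreal_leI)
    qed (simp add: hausdorff_gauge_def)
    finally show ?thesis by (simp add: mult_left_mono)
  qed (simp add: V_def)
  then have "(\<Sum>i. emeasure lborel (V i)) \<le> (\<Sum>i. 2 * hausdorff_gauge s (U i))"
    by (intro suminf_le) auto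
  then show "emeasure lborel (\<Union>i. V i) \<le> 2 * (\<Sum>i. hausdorff_gauge s (U i))"
    using emeasure_subadditive_countably[of V lborel] V by (force simp: image_subset_iff)
qed

lemma hausdorff_premeasure_null_imp_null_sets:
  fixes A :: "real set"
  assumes "hausdorff_premeasure s 1 A = 0" "s \<le> 1"
  shows "A \<in> null_sets lebesgue"
proof -
  have "\<exists>T. A \<subseteq> T \<and> T \<in> lmeasurable \<and> measure lebesgue T < e" if e: "e > 0" for e :: real
  proof -
    obtain U where U: "A \<subseteq> (\<Union>i. U i)" "\<And>i. bounded (U i)" "\<And>i. diameter (U i) \<le> 1"
      "(\<Sum>i. hausdorff_gauge s (U i)) < 0 + ennreal (e/4)"
      using hausdorff_premeasure_approx[of s 1 A "e/4"] assms e by auto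
    obtain T where T: "T \<in> sets borel" "(\<Union>i. U i) \<subseteq> T"
      "emeasure lborel T \<le> 2 * (\<Sum>i. hausdorff_gauge s (U i))"
      using borel_cover_diameter[OF U(2,3) assms(2)] .
    have "2 * (\<Sum>i. hausdorff_gauge s (U i)) \<le> 2 * ennreal (e/4)"
      using U(4) by (intro mult_left_mono) auto
    also have "\<dots> = ennreal (e/2)"
      using ennreal_mult[of 2 "e/4"] e by simp
    finally have "emeasure lborel T \<le> ennreal (e/2)" using T(3) by (rule order_trans[rotated])
    then have E: "emeasure lebesgue T \<le> ennreal (e/2)"
      using T(1) by (simp add: emeasure_completion)
    have "T \<in> lmeasurable"
      using T(1) E by (intro fmeasurableI) (auto simp: order_le_less_trans ennreal_less_top)
    moreover have "measure lebesgue T \<le> e/2"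
      unfolding measure_def using E e by (intro enn2real_leI) auto
    ultimately show ?thesis using U(1) T(2) e by (intro exI[of _ T]) auto
  qed
  then have "negligible A" by (subst negligible_outer) blast
  then show ?thesis by (simp add: negligible_iff_null_sets)
qed

text \<open>A cover of \<open>A\<close> is pulled back along the inverse Hoelder map \<open>f\<close> to a cover of the
  unit interval, whose Lebesgue measure is 1.\<close>

lemma hausdorff_dim_ge_inverse_Hoelder:
  fixes f :: "real \<Rightarrow> real" and A :: "real set"
  assumes f: "f ` {0..<1} \<subseteq> A" and s: "0 < s"
    and inv: "\<And>x y. x \<in> {0..<1} \<Longrightarrow> y \<in> {0..<1} \<Longrightarrow> \<bar>x - y\<bar> \<le> 2 * \<bar>f x - f y\<bar> powr s"
  shows "ennreal s \<le> hausdorff_dim A"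
  unfolding hausdorff_dim_def
proof (rule INF_greatest)
  fix t :: real assume "t \<in> {s. 0 \<le> s \<and> hausdorff_measure s A = 0}"
  then have t: "0 \<le> t" "hausdorff_measure t A = 0" by auto
  show "ennreal s \<le> ennreal t"
  proof (rule ccontr)
    assume "\<not> ennreal s \<le> ennreal t"
    then have ts: "t < s" by (meson ennreal_leI not_le)
    \<comment> \<open>With \<open>\<delta> powr s = 1/2\<close> the pulled back sets have diameter
      at most \<open>2 * \<delta> powr s = 1\<close>, as the comparison with Lebesgue measure
      demands.\<close>
    define \<delta> :: real where "\<delta> = (1/2) powr (1 / s)"
    have \<delta>: "0 < \<delta>" "\<delta> powr s = 1/2" "\<delta> \<le> 1"
      using s by (auto simp: \<delta>_def powr_powr intro: powr_le1)
    have "hausdorff_premeasure t \<delta> A \<le> hausdorff_measure t A"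
      unfolding hausdorff_measure_def using \<delta> by (intro SUP_upper) auto
    then have "hausdorff_premeasure t \<delta> A = 0" using t by simp
    \<comment> \<open>The bound 1/8 is doubled by the Hoelder constant and again by the passage to
      intervals; this leaves 1/2, less than the length of the unit interval.\<close>
    then obtain U where U: "A \<subseteq> (\<Union>i. U i)" "\<And>i. bounded (U i)" "\<And>i. diameter (U i) \<le> \<delta>"
      "(\<Sum>i. hausdorff_gauge t (U i)) < 0 + ennreal (1/8)"
      using hausdorff_premeasure_approx[of t \<delta> A "1/8"] by auto
    define W where "W = (\<lambda>i. {x \<in> {0..<1}. f x \<in> U i})"
    have Wcov: "{0..<1} \<subseteq> (\<Union>i. W i)" using f U(1) by (fastforce simp: W_def)
    have Wb: "bounded (W i)" for i by (rule bounded_subset[of "{0..<1}"]) (auto simp: W_def)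
    have Wd: "diameter (W i) \<le> 2 * diameter (U i) powr s" for i
    proof (rule diameter_le)
      fix x y assume xy: "x \<in> W i" "y \<in> W i"
      have "\<bar>f x - f y\<bar> \<le> diameter (U i)"
        using diameter_bounded_bound[OF U(2)[of i], of "f x" "f y"] xy
        by (auto simp: W_def dist_real_def)
      then have "\<bar>f x - f y\<bar> powr s \<le> diameter (U i) powr s"
        using s by (intro powr_mono2) auto
      then show "norm (x - y) \<le> 2 * diameter (U i) powr s"
        using inv[of x y] xy by (auto simp: W_def)
    qed simp
    have d0: "0 \<le> diameter (U i)" for i using U(2) diameter_ge_0 by blast
    have Wd1: "diameter (W i) \<le> 1" for i
    proof -
      have "diameter (U i) powr s \<le> \<delta> powr s" using s U(3)[of i] d0[of i] by (intro powr_mono2) auto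
      then show ?thesis using Wd[of i] \<delta> by simp
    qed
    obtain T where T: "T \<in> sets borel" "(\<Union>i. W i) \<subseteq> T"
      "emeasure lborel T \<le> 2 * (\<Sum>i. hausdorff_gauge 1 (W i))"
      using borel_cover_diameter[of W 1] Wb Wd1 by blast
    have "hausdorff_gauge 1 (W i) \<le> 2 * hausdorff_gauge t (U i)" for i
    proof (cases "W i = {}")
      case False
      then have Ui: "U i \<noteq> {}" by (auto simp: W_def)
      have "hausdorff_gauge 1 (W i) \<le> ennreal (2 * diameter (U i) powr s)"
        using Wd[of i] False diameter_ge_0[OF Wb] by (auto simp: hausdorff_gauge_def intro: ennreal_leI)
      also have "\<dots> = 2 * ennreal (diameter (U i) powr s)" by (simp add: ennreal_mult)
      also have "ennreal (diameter (U i) powr s) \<le> hausdorff_gauge t (U i)"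
      \<comment> \<open>At \<open>t = 0\<close> a nonempty set contributes 1, whereas
        \<open>powr\<close> would give 0 at diameter 0.\<close>
      proof (cases "t = 0")
        case True
        have "diameter (U i) powr s \<le> 1"
          using s d0[of i] U(3)[of i] \<delta>(3) by (intro powr_le1) auto
        then show ?thesis using True Ui
          by (simp add: hausdorff_gauge_def)
      next
        case False
        have "diameter (U i) powr s \<le> diameter (U i) powr t"
          using d0[of i] U(3)[of i] \<delta>(3) ts by (intro powr_mono') auto
        then show ?thesis using False Ui by (simp add: hausdorff_gauge_def ennreal_leI)
      qed
      finally show ?thesis by (simp add: mult_left_mono)
    qed (simp add: hausdorff_gauge_def)
    then have "(\<Sum>i. hausdorff_gauge 1 (W i)) \<le> (\<Sum>i. 2 * hausdorff_gauge t (U i))"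
      by (intro suminf_le) auto
    also have "\<dots> \<le> 2 * ennreal (1/8)" using U(4) by (simp add: mult_left_mono less_imp_le)
    finally have "2 * (\<Sum>i. hausdorff_gauge 1 (W i)) \<le> 2 * (2 * ennreal (1/8))"
      by (rule mult_left_mono) simp
    also have "\<dots> = ennreal (1/2)"
      using ennreal_mult[of 2 "1/8"] ennreal_mult[of 2 "1/4"] by simp
    finally have "emeasure lborel T \<le> ennreal (1/2)" using T(3) by (rule order_trans[rotated])
    moreover have "emeasure lborel {0..<1::real} \<le> emeasure lborel T"
      using T Wcov by (intro emeasure_mono) auto
    ultimately have "(1::ennreal) \<le> ennreal (1/2)" by simp
    then show False using ennreal_le_iff[of "1/2" 1] by simp
  qed
qed

lemma uncountable_if_hausdorff_dim_pos:
  fixes A :: "'a::metric_space set"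
  assumes "0 < hausdorff_dim A"
  shows "uncountable A"
proof
  assume A: "countable A"
  have le: "hausdorff_dim A \<le> ennreal s" if "0 < s" for s :: real
    unfolding hausdorff_dim_def
  proof (rule INF_lower)
    show "s \<in> {s. 0 \<le> s \<and> hausdorff_measure s A = 0}"
      using hausdorff_measure_eq_0[OF hausdorff_premeasure_null_countable[OF A that] that] that by simp
  qed
  have "hausdorff_dim A \<le> 0"
    by (rule ennreal_le_epsilon) (simp add: le)
  with assms show False by simp
qed

subsection \<open>The discrepancy sequence\<close>

lemma frac_add_int [simp]: "frac (x + of_int m) = frac x"
  by (simp add: frac_def)

lemma frac_irrational_neq:
  fixes x :: real
  assumes "x \<notin> \<rat>" "c \<in> \<rat>"
  shows "frac x \<noteq> c"
proof
  assume "frac x = c"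
  then have "x = c + of_int \<lfloor>x\<rfloor>" by (simp add: frac_def)
  then have "x \<in> \<rat>" using assms(2) by (metis Rats_add Rats_of_int)
  with assms show False by simp
qed

lemma of_nat_mult_irrational:
  fixes x :: real
  assumes "x \<notin> \<rat>" "0 < j"
  shows "of_nat j * x \<notin> \<rat>"
proof
  assume "of_nat j * x \<in> \<rat>"
  then have "of_nat j * x / of_nat j \<in> \<rat>" by (rule Rats_divide) auto
  with assms show False by simp
qed

lemma discrepancy_0 [simp]: "discrepancy x c 0 = 0"
  by (simp add: discrepancy_def)

lemma discrepancy_add_int: "discrepancy (x + of_int m) c n = discrepancy x c n"
proof -
  have "frac (real j * (x + of_int m)) = frac (real j * x)" for j
    using frac_add_int[of "real j * x" "int j * m"] by (simp add: algebra_simps)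
  then show ?thesis by (simp add: discrepancy_def)
qed

lemma discrepancy_eq_card:
  assumes "0 \<le> c"
  shows "discrepancy x c n = real (card {j \<in> {1..n}. frac (real j * x) < c}) - c * real n"
proof -
  have "(\<Sum>j=1..n. indicat_real {0..<c} (frac (real j * x)))
      = (\<Sum>j\<in>{j \<in> {1..n}. frac (real j * x) < c}. 1)"
    by (rule sum.mono_neutral_cong_right) (auto simp: indicator_def frac_ge_0)
  then show ?thesis by (simp add: discrepancy_def)
qed

text \<open>Irrationality keeps \<open>j x\<close> off 0 and off \<open>c\<close> modulo 1, so
  reflection turns [0, 1 - c) into the complement of [0, c) without trouble at the ends.\<close>

lemma discrepancy_uminus:
  assumes "x \<notin> \<rat>" "c \<in> \<rat>"
  shows "discrepancy (- x) (1 - c) n = - discrepancy x c n"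
proof -
  have "indicat_real {0..<1-c} (frac (real j * - x)) = 1 - indicat_real {0..<c} (frac (real j * x))"
    if "j \<in> {1..n}" for j
  proof -
    have irr: "real j * x \<notin> \<rat>" using of_nat_mult_irrational[OF assms(1), of j] that by simp
    then have "real j * x \<notin> \<int>" using Ints_subset_Rats by blast
    then have "frac (real j * - x) = 1 - frac (real j * x)" by (simp add: frac_neg)
    moreover have "frac (real j * x) \<noteq> c" using frac_irrational_neq[OF irr assms(2)] .
    ultimately show ?thesis
      using frac_ge_0[of "real j * x"] frac_lt_1[of "real j * x"] by (auto simp: indicator_def)
  qed
  then have "(\<Sum>j=1..n. indicat_real {0..<1-c} (frac (real j * - x)))
      = (\<Sum>j=1..n. 1 - indicat_real {0..<c} (frac (real j * x)))"
    by (intro sum.cong) auto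
  then show ?thesis
    unfolding discrepancy_def by (simp add: sum_subtractf algebra_simps)
qed

subsection \<open>Necessary condition for boundedness from below\<close>

text \<open>Each admissible pair removes the open interval of length 1/(k q^2) to the left of p/q,
  so what remains is closed. The threshold \<open>Q\<close> splits the condition that only finitely
  many such approximations exist into countably many closed ones. Denominator 0 is excluded, as
  \<open>k\<close> divides it.\<close>

definition no_close_upper :: "nat \<Rightarrow> nat \<Rightarrow> real set" where
  "no_close_upper k Q = {x. \<forall>p q. int Q \<le> q \<and> coprime p q \<and> \<not> int k dvd q \<longrightarrow>
     \<not> (0 < of_int p - of_int q * x \<and> of_int q * (of_int p - of_int q * x) * real k < 1)}"

lemma closed_no_close_upper: "closed (no_close_upper k Q)"
proof -
  have "no_close_upper k Q = (\<Inter>(p, q)\<in>{(p, q). int Q \<le> q \<and> coprime p q \<and> \<not> int k dvd q}.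
      - {x. 0 < of_int p - of_int q * x \<and> of_int q * (of_int p - of_int q * x) * real k < 1})"
    by (auto simp: no_close_upper_def)
  also have "closed \<dots>"
    by (intro closed_INT ballI)
      (auto intro!: open_Collect_conj open_Collect_less continuous_intros simp: closed_Compl)
  finally show ?thesis .
qed

text \<open>The points \<open>j x\<close> with \<open>1 \<le> j \<le> q\<close> are the multiples of \<open>1/q\<close>, each moved to the left by less
  than \<open>1/(k q)\<close>; this pushes \<open>0\<close> out of the interval and moves no other point across \<open>h/k\<close>.\<close>

lemma discrepancy_close_upper:
  fixes p q :: int
  assumes k: "0 < k" and hk: "coprime h k" "h < k" and c: "c = real h / real k"
    and pq: "0 < q" "coprime p q" "\<not> int k dvd q"
    and x: "0 < of_int p - of_int q * x" "of_int q * (of_int p - of_int q * x) * real k < 1"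
  shows "discrepancy x c (nat q) \<le> - 1 / real k"
proof -
  define \<delta> where "\<delta> = of_int p - of_int q * x"
  have \<delta>: "0 < \<delta>" "of_int q * \<delta> * real k < 1" using x by (auto simp: \<delta>_def)
  define S where "S = {j \<in> {1..nat q}. frac (real j * x) < c}"
  \<comment> \<open>\<open>f j\<close> is the numerator \<open>i\<close> of the multiple
    \<open>i/q\<close> from which \<open>j x\<close> is displaced modulo 1.\<close>
  define f where "f = (\<lambda>j. (int j * p) mod q)"
  have inj: "inj_on f S"
  proof (rule inj_onI)
    fix i j assume ij: "i \<in> S" "j \<in> S" "f i = f j"
    then have "q dvd int i * p - int j * p" by (simp add: f_def mod_eq_dvd_iff)
    then have "q dvd (int i - int j) * p" by (simp add: left_diff_distrib)
    then have "q dvd int i - int j" using pq(2) by (simp add: coprime_dvd_mult_left_iff coprime_commute)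
    moreover have "\<bar>int i - int j\<bar> < q" using ij pq by (auto simp: S_def)
    ultimately show "i = j" using pq(1) by (metis dvd_imp_le_int not_less abs_of_pos right_minus_eq of_nat_eq_iff)
  qed
  have im: "f ` S \<subseteq> {1..int ((h * nat q) div k)}"
  proof clarify
    fix j assume j: "j \<in> S"
    define i where "i = f j"
    have i: "0 \<le> i" "i < q" using pq by (auto simp: i_def f_def)
    define m where "m = (int j * p) div q"
    have m: "int j * p = m * q + i" by (simp add: m_def i_def f_def)
    define \<sigma> where "\<sigma> = real j * \<delta> / of_int q"
    have j': "1 \<le> j" "real j \<le> of_int q" "frac (real j * x) < c"
      using j pq by (auto simp: S_def)
    have \<sigma>: "0 < \<sigma>" using j' \<delta> pq by (auto simp: \<sigma>_def)
    have \<sigma>2: "\<sigma> * of_int q * real k < 1"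
    proof -
      have "real j * \<delta> * real k \<le> of_int q * \<delta> * real k"
        using j' \<delta> by (intro mult_right_mono) auto
      moreover have "\<sigma> * of_int q * real k = real j * \<delta> * real k" using pq by (simp add: \<sigma>_def)
      ultimately show ?thesis using \<delta>(2) by linarith
    qed
    have "real j * x = of_int (int j * p) / of_int q - \<sigma>"
      using pq by (simp add: \<sigma>_def \<delta>_def field_simps)
    then have jx: "real j * x = of_int i / of_int q - \<sigma> + of_int m"
      unfolding m using pq by (simp add: field_simps)
    then have fr: "frac (real j * x) = frac (of_int i / of_int q - \<sigma>)" by simp
    have k2: "h + 1 \<le> k" using hk by simp
    have q1: "1 \<le> real_of_int q" using pq by simp
    have k1: "1 \<le> real k" using k by simp
    have \<sigma>k: "\<sigma> * real k < 1"
    proof -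
      have "\<sigma> * real k * 1 \<le> \<sigma> * real k * of_int q" using \<sigma> q1 by (intro mult_left_mono) auto
      then show ?thesis using \<sigma>2 by (simp add: mult_ac)
    qed
    have \<sigma>q: "\<sigma> * of_int q < 1"
    proof -
      have "\<sigma> * of_int q * 1 \<le> \<sigma> * of_int q * real k" using \<sigma> k1 pq by (intro mult_left_mono) auto
      then show ?thesis using \<sigma>2 by simp
    qed
    \<comment> \<open>The multiple 0 moves to \<open>1 - \<sigma>\<close>, and
      \<open>\<sigma> < 1/k \<le> 1 - c\<close> keeps it outside [0, c).\<close>
    have "i \<noteq> 0"
    proof
      assume "i = 0"
      have "\<sigma> * 1 \<le> \<sigma> * of_int q" using \<sigma> q1 by (intro mult_left_mono) auto
      then have "\<sigma> < 1" using \<sigma>q by simp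
      then have "frac (- \<sigma>) = 1 - \<sigma>" using \<sigma> by (subst frac_unique_iff) (auto simp: algebra_simps)
      then have "1 - \<sigma> < c" using fr j' \<open>i = 0\<close> by simp
      then have "real k - \<sigma> * real k < real h" using k c by (simp add: field_simps)
      then show False using \<sigma>k k2 by linarith
    qed
    then have i1: "1 \<le> i" using i by simp
    have "frac (of_int i / of_int q - \<sigma>) = of_int i / of_int q - \<sigma>"
    proof (subst frac_eq, intro conjI)
      have "1 / of_int q \<le> of_int i / real_of_int q" using i1 pq by (simp add: divide_right_mono)
      moreover have "\<sigma> < 1 / of_int q" using \<sigma>q pq by (simp add: field_simps)
      ultimately show "0 \<le> of_int i / of_int q - \<sigma>" by simp
      have "of_int i / real_of_int q < 1" using i pq by simp
      then show "of_int i / of_int q - \<sigma> < 1" using \<sigma> by simp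
    qed
    then have "of_int i / of_int q - \<sigma> < c" using fr j' by simp
    then have "of_int i * real k < real h * of_int q + \<sigma> * of_int q * real k"
      using k c pq by (simp add: field_simps)
    then have "of_int i * real k < real h * of_int q + 1" using \<sigma>2 by simp
    then have "real_of_int (i * int k) < real_of_int (int h * q + 1)" by simp
    then have "i * int k \<le> int h * q" by linarith
    then have "(i * int k) div int k \<le> (int h * q) div int k" using k by (intro zdiv_mono1) auto
    then have "i \<le> (int h * q) div int k" using k by simp
    also have "\<dots> = int ((h * nat q) div k)" using pq by (simp add: zdiv_int)
    finally show "f j \<in> {1..int ((h * nat q) div k)}" using i1 by (simp add: i_def)
  qed
  have "card S \<le> card {1..int ((h * nat q) div k)}"
    using card_inj_on_le[OF inj im] by simp
  then have card: "card S \<le> (h * nat q) div k" by simp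
  \<comment> \<open>Here \<open>k\<close> not dividing \<open>q\<close> gives the deficit:
    \<open>h q / k\<close> is not an integer, so its floor is smaller by at least 1/k.\<close>
  have "\<not> k dvd h * nat q"
  proof
    assume "k dvd h * nat q"
    then have "k dvd nat q" using hk(1) by (simp add: coprime_dvd_mult_right_iff coprime_commute)
    then have "int k dvd q" using pq(1) by (metis int_dvd_int_iff int_nat_eq less_imp_le)
    then show False using pq by simp
  qed
  then have "(h * nat q) mod k \<ge> 1" by (simp add: dvd_eq_mod_eq_0)
  then have "k * ((h * nat q) div k) + 1 \<le> h * nat q"
    by (metis add_le_cancel_left mult_div_mod_eq)
  then have "k * card S + 1 \<le> h * nat q"
    using card by (meson add_le_mono1 le_trans mult_le_mono2)
  then have "real k * real (card S) + 1 \<le> real h * real (nat q)"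
    by (metis of_nat_1 of_nat_add of_nat_le_iff of_nat_mult)
  moreover have "real h = c * real k" using k c by simp
  ultimately have "(real (card S) - c * real (nat q)) * real k \<le> - 1" by (simp add: algebra_simps)
  then have "real (card S) - c * real (nat q) \<le> - 1 / real k"
    using k pos_le_divide_eq[of "real k" _ "- 1"] by simp
  then show ?thesis using discrepancy_eq_card[of c x "nat q"] c by (simp add: S_def)
qed

lemma frac_indicator_left_stable:
  fixes y :: real
  assumes "y \<notin> \<rat>" "c \<in> \<rat>" "0 \<le> c"
  shows "\<forall>\<^sub>F d in at_right 0. indicat_real {0..<c} (frac (y - d)) = indicat_real {0..<c} (frac y)"
proof -
  \<comment> \<open>The shift may cross neither 0 nor \<open>c\<close>; if
    \<open>frac y < c\<close>, only 0 lies in the way and 1 stands in for the second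
    distance.\<close>
  define d0 where "d0 = min (frac y) (if frac y < c then 1 else frac y - c)"
  have "frac y \<noteq> 0" using assms(1) frac_irrational_neq[OF assms(1), of 0] by simp
  moreover have "frac y \<noteq> c" using frac_irrational_neq[OF assms(1,2)] .
  ultimately have "0 < d0" using frac_ge_0[of y] by (auto simp: d0_def)
  then have "\<forall>\<^sub>F d in at_right 0. d \<in> {0<..<d0}" by (rule eventually_at_right_real)
  then show ?thesis
  proof eventually_elim
    case (elim d)
    then have "frac (y - d) = frac y - d"
      using frac_lt_1[of y] by (subst frac_unique_iff) (auto simp: d0_def frac_def)
    then show ?case using elim by (auto simp: indicator_def d0_def split: if_splits)
  qed
qed

text \<open>Prepending a block of length \<open>q\<close> with \<open>q x\<close> just below an integer leaves the contribution of
  the last \<open>N\<close> points unchanged, so the defects of sparse good denominators add up.\<close>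

lemma bdd_below_imp_no_close_upper:
  assumes k: "0 < k" and hk: "coprime h k" "h < k" and c: "c = real h / real k"
    and irr: "x \<notin> \<rat>" and bdd: "bdd_below (range (discrepancy x c))"
  shows "\<exists>Q. x \<in> no_close_upper k Q"
proof (rule ccontr)
  assume no: "\<nexists>Q. x \<in> no_close_upper k Q"
  have cR: "c \<in> \<rat>" "0 \<le> c" by (auto simp: c)
  have "\<exists>N. discrepancy x c N \<le> - real m / real k" for m
  proof (induction m)
    case 0
    then show ?case by (intro exI[of _ 0]) simp
  next
    case (Suc m)
    then obtain N where N: "discrepancy x c N \<le> - real m / real k" by blast
    have "\<forall>\<^sub>F d in at_right 0. \<forall>j\<in>{1..N}.
        indicat_real {0..<c} (frac (real j * x - d)) = indicat_real {0..<c} (frac (real j * x))"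
      using frac_indicator_left_stable[OF of_nat_mult_irrational[OF irr] cR]
      by (intro eventually_ball_finite) auto
    then obtain \<eta> where \<eta>: "0 < \<eta>" "\<And>d j. 0 < d \<Longrightarrow> d < \<eta> \<Longrightarrow> j \<in> {1..N} \<Longrightarrow>
        indicat_real {0..<c} (frac (real j * x - d)) = indicat_real {0..<c} (frac (real j * x))"
      unfolding eventually_at_right_field by blast
    \<comment> \<open>The error \<open>d\<close> of a good denominator \<open>q\<close> is below
      1/(k q), so \<open>q > 1/\<eta>\<close> puts it below \<eta>, the shift that the
      \<open>N\<close> points already chosen tolerate. This is where the denominators become
      sparse.\<close>
    obtain Q :: nat where Q: "1 / \<eta> < real Q" using reals_Archimedean2 by blast
    have "x \<notin> no_close_upper k (Suc Q)" using no by blast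
    then obtain p q where pq: "int (Suc Q) \<le> q" "coprime p q" "\<not> int k dvd q"
      "0 < of_int p - of_int q * x" "of_int q * (of_int p - of_int q * x) * real k < 1"
      by (auto simp: no_close_upper_def)
    define d where "d = of_int p - of_int q * x"
    have q: "0 < q" using pq by simp
    have "real Q < of_int q" using pq(1) by linarith
    then have qe: "1 < \<eta> * of_int q" using Q \<eta>(1) by (simp add: field_simps) 
        (metis less_trans mult.commute mult_strict_left_mono)
    have "of_int q * d * 1 \<le> of_int q * d * real k"
      using q pq(4) k by (intro mult_left_mono) (auto simp: d_def)
    then have "of_int q * d < of_int q * \<eta>" using pq(5) qe by (simp add: d_def mult_ac)
    then have d: "0 < d" "d < \<eta>" using q pq(4) by (auto simp: d_def)
    have sh: "frac (real (j + nat q) * x) = frac (real j * x - d)" for j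
      using q frac_add_int[of "real j * x - d" p] by (simp add: d_def algebra_simps)
    have "(\<Sum>j=1..N + nat q. indicat_real {0..<c} (frac (real j * x)))
        = (\<Sum>j=1..nat q. indicat_real {0..<c} (frac (real j * x)))
        + (\<Sum>j=1+nat q..N + nat q. indicat_real {0..<c} (frac (real j * x)))"
      using sum.ub_add_nat[of 1 "nat q" _ N] by (simp add: add_ac)
    also have "(\<Sum>j=1+nat q..N + nat q. indicat_real {0..<c} (frac (real j * x)))
        = (\<Sum>j=1..N. indicat_real {0..<c} (frac (real (j + nat q) * x)))"
      by (rule sum.shift_bounds_cl_nat_ivl)
    also have "\<dots> = (\<Sum>j=1..N. indicat_real {0..<c} (frac (real j * x)))"
      unfolding sh using \<eta>(2)[OF d] by (intro sum.cong) auto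
    finally have "discrepancy x c (N + nat q) = discrepancy x c (nat q) + discrepancy x c N"
      by (simp add: discrepancy_def algebra_simps)
    moreover have "discrepancy x c (nat q) \<le> - 1 / real k"
      using discrepancy_close_upper[OF k hk c q pq(2-5)] .
    ultimately have "discrepancy x c (N + nat q) \<le> - real (Suc m) / real k"
      using N by (simp add: diff_divide_distrib)
    then show ?case by blast
  qed
  moreover obtain B where B: "\<And>n. B \<le> discrepancy x c n" using bdd by (auto simp: bdd_below_def)
  moreover obtain m :: nat where "- B * real k < real m" using reals_Archimedean2 by blast
  then have "- real m / real k < B" using k by (simp add: field_simps)
  ultimately show False by (meson less_le_trans not_less order_trans)
qed

subsection \<open>Upper bound for the dimension\<close>

text \<open>If \<open>u = q'/q\<close> is the quotient of the last two denominators, \<open>cf_ratio u a\<close> is the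
  proportion of a continued fraction cylinder taken up by the next partial quotient \<open>a\<close>.\<close>

definition cf_ratio :: "real \<Rightarrow> nat \<Rightarrow> real" where
  "cf_ratio u a = (1 + u) / ((real a + u) * (real a + 1 + u))"

lemma cf_ratio_pos: "0 \<le> u \<Longrightarrow> 0 < cf_ratio u (Suc a)"
  by (auto simp: cf_ratio_def intro!: divide_pos_pos mult_pos_pos add_pos_nonneg)

lemma cf_ratio_telescope:
  assumes "0 \<le> u"
  shows "cf_ratio u (Suc a) = (1 + u) / (real a + 1 + u) - (1 + u) / (real (Suc a) + 1 + u)"
proof -
  have "0 < real a + 1 + u" using assms by simp
  then have "0 < 1 + (u + real a)" by simp
  moreover from this have "0 < 2 + (u + real a)" by simp
  ultimately show ?thesis
    by (simp add: cf_ratio_def divide_simps) (simp add: algebra_simps)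
qed

lemma cf_ratio_sums:
  assumes "0 \<le> u"
  shows "(\<lambda>a. cf_ratio u (Suc a)) sums 1"
proof -
  have "(\<lambda>n. (1 + u) / (real n + 1 + u)) \<longlonglongrightarrow> 0" by real_asymp
  from telescope_sums'[OF this] show ?thesis
    using assms by (simp add: cf_ratio_telescope)
qed

lemma cf_ratio_sum_lessThan:
  assumes "0 \<le> u"
  shows "(\<Sum>a<n. cf_ratio u (Suc a)) = 1 - (1 + u) / (real n + 1 + u)"
  using assms by (induction n) (simp_all add: cf_ratio_telescope)

lemma cf_ratio_le:
  assumes "0 \<le> u" "u \<le> 1"
  shows "cf_ratio u (Suc a) \<le> 2 / (real (Suc a))\<^sup>2"
  unfolding cf_ratio_def power2_eq_square
  using assms by (intro frac_le mult_mono) auto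

text \<open>For \<open>a = 2\<close> the value 1/6 occurs at both \<open>u = 0\<close> and
  \<open>u = 1\<close>; in between, \<open>u * u \<le> u\<close> suffices.\<close>

lemma cf_ratio_ge_sixth:
  assumes "0 \<le> u" "u \<le> 1" "a \<in> {1, 2}"
  shows "1 / 6 \<le> cf_ratio u a"
proof -
  have "u * u \<le> u * 1" using assms by (intro mult_left_mono) auto
  then have "(real a + u) * (real a + 1 + u) \<le> 6 * (1 + u)"
    using assms by (auto simp: algebra_simps)
  moreover have "0 < (real a + u) * (real a + 1 + u)"
    using assms by (intro mult_pos_pos) auto
  ultimately show ?thesis by (simp add: cf_ratio_def pos_le_divide_eq)
qed

lemma summable_powr_three_halves: "summable (\<lambda>n. 2 * real (Suc n) powr (- (3/2)))"
proof -
  have "summable (\<lambda>n. real n powr (- (3/2)))" by (simp add: summable_real_powr_iff)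
  then have "summable (\<lambda>n. real (Suc n) powr (- (3/2)))" by (subst summable_Suc_iff)
  then show ?thesis by (rule summable_mult)
qed

text \<open>Decay like 1/a^2 leaves the powers summable for exponents above 1/2. The choice 3/4
  leaves room below 1 for all exponents \<open>1 - \<epsilon>\<close> with
  \<open>\<epsilon> \<le> 1/4\<close>.\<close>

lemma cf_ratio_powr_le:
  assumes "0 \<le> u" "u \<le> 1"
  shows "cf_ratio u (Suc a) powr (3/4) \<le> 2 * real (Suc a) powr (- (3/2))"
proof -
  have "cf_ratio u (Suc a) powr (3/4) \<le> (2 / (real (Suc a))\<^sup>2) powr (3/4)"
    using cf_ratio_le[OF assms, of a] cf_ratio_pos[OF assms(1), of a] by (intro powr_mono2) auto
  also have "\<dots> = 2 powr (3/4) * ((real (Suc a))\<^sup>2 powr (- (3/4)))"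
    by (simp add: powr_divide powr_minus_divide del: of_nat_Suc)
  also have "(real (Suc a))\<^sup>2 powr (- (3/4)) = real (Suc a) powr (- (3/2))"
    using powr_powr[of "real (Suc a)" 2 "- (3/4)"] by (simp add: powr_numeral del: of_nat_Suc)
  also have "2 powr (3/4::real) \<le> 2 powr 1" by (intro powr_mono) auto
  finally show ?thesis by (simp add: mult_right_mono del: of_nat_Suc)
qed

text \<open>Bernoulli's inequality for \<open>w powr (-1/4)\<close> with exponent \<open>4 \<epsilon>\<close>.\<close>

lemma powr_one_minus_le:
  fixes w \<epsilon> :: real
  assumes "0 < w" "0 \<le> \<epsilon>" "\<epsilon> \<le> 1/4"
  shows "w powr (1 - \<epsilon>) \<le> w + 4 * \<epsilon> * w powr (3/4)"
proof -
  define v where "v = w powr (- (1/4))"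
  have v: "0 < v" using assms by (simp add: v_def)
  have "v powr (4 * \<epsilon>) * 1 powr (1 - 4 * \<epsilon>) \<le> (4 * \<epsilon>) * v + (1 - 4 * \<epsilon>) * 1"
    using Youngs_inequality_0[of "4 * \<epsilon>" "1 - 4 * \<epsilon>" v 1] v assms by simp
  then have "v powr (4 * \<epsilon>) \<le> 1 + 4 * \<epsilon> * v" using assms by simp
  then have "w * v powr (4 * \<epsilon>) \<le> w * (1 + 4 * \<epsilon> * v)" using assms by (intro mult_left_mono) auto
  also have "w * v powr (4 * \<epsilon>) = w powr (1 - \<epsilon>)"
  proof -
    have "v powr (4 * \<epsilon>) = w powr (- \<epsilon>)" unfolding v_def powr_powr by simp
    then have "w * v powr (4 * \<epsilon>) = w powr 1 * w powr (- \<epsilon>)" using assms by simp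
    also have "\<dots> = w powr (1 - \<epsilon>)" by (subst powr_add[symmetric]) simp
    finally show ?thesis .
  qed
  also have "w * (1 + 4 * \<epsilon> * v) = w + 4 * \<epsilon> * (w powr 1 * w powr (- (1/4)))"
    using assms by (simp add: v_def algebra_simps)
  also have "w powr 1 * w powr (- (1/4)) = w powr (3/4)" by (subst powr_add[symmetric]) simp
  finally show ?thesis .
qed

text \<open>Twice the value of the Riemann zeta function at 3/2: a bound, uniform in
  \<open>u\<close>, for the sum of the proportions to the power 3/4. It measures the cost of
  lowering the exponent from 1.\<close>

definition cf_zeta :: real where
  "cf_zeta = (\<Sum>n. 2 * real (Suc n) powr (- (3/2)))"

lemma cf_zeta_sums: "(\<lambda>n. 2 * real (Suc n) powr (- (3/2))) sums cf_zeta"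
  unfolding cf_zeta_def using summable_powr_three_halves by (rule summable_sums)

text \<open>This sums over the second quotient of a block whose first quotient has proportion
  \<open>g\<close>. The quotients below \<open>k\<close> telescope to 1 - (1 + u)/(k + u), at most 1
  - 1/k; lowering the exponent by \<epsilon> costs \<open>4 * \<epsilon>\<close> times the sum at
  exponent 3/4.\<close>

lemma cf_ratio_inner_sum_le:
  assumes u: "0 \<le> u" "u \<le> 1" and g: "0 < g" and \<epsilon>: "0 \<le> \<epsilon>" "\<epsilon> \<le> 1/4" and k: "0 < k"
  shows "(\<Sum>b. if ok \<or> Suc b < k then ennreal ((g * cf_ratio u (Suc b)) powr (1 - \<epsilon>)) else 0)
    \<le> ennreal (g * (if ok then 1 else 1 - 1 / real k) + 4 * \<epsilon> * g powr (3/4) * cf_zeta)"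
proof -
  let ?z = "\<lambda>n. 2 * real (Suc n) powr (- (3/2))"
  define f where "f = (\<lambda>b. if ok \<or> Suc b < k then cf_ratio u (Suc b) else 0)"
  have pos: "0 < cf_ratio u (Suc b)" for b using cf_ratio_pos u by simp
  have "\<exists>S. f sums S \<and> S \<le> (if ok then 1 else 1 - 1 / real k)"
  proof (cases ok)
    case True
    then show ?thesis using cf_ratio_sums[OF u(1)] by (auto simp: f_def)
  next
    case False
    obtain l where l: "k = Suc l" using k by (metis gr0_implies_Suc)
    have "f sums (\<Sum>b<l. f b)" by (rule sums_finite) (auto simp: f_def False l)
    moreover have "(\<Sum>b<l. f b) = (\<Sum>b<l. cf_ratio u (Suc b))"
      by (intro sum.cong) (auto simp: f_def l)
    moreover have "1 / real k \<le> (1 + u) / (real l + 1 + u)"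
    proof -
      have "real l * 0 \<le> real l * u" using u by (intro mult_left_mono) auto
      then show ?thesis using u by (simp add: l frac_le_eq divide_le_eq le_divide_eq algebra_simps)
    qed
    ultimately show ?thesis using False cf_ratio_sum_lessThan[OF u(1), of l] by auto
  qed
  then obtain S where S: "f sums S" "S \<le> (if ok then 1 else 1 - 1 / real k)" by blast
  have "(if ok \<or> Suc b < k then ennreal ((g * cf_ratio u (Suc b)) powr (1 - \<epsilon>)) else 0)
      \<le> ennreal (g * f b + 4 * \<epsilon> * g powr (3/4) * ?z b)" for b
  proof (cases "ok \<or> Suc b < k")
    case True
    have "(g * cf_ratio u (Suc b)) powr (1 - \<epsilon>)
        \<le> g * cf_ratio u (Suc b) + 4 * \<epsilon> * (g * cf_ratio u (Suc b)) powr (3/4)"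
      using g pos[of b] \<epsilon> by (intro powr_one_minus_le) auto
    also have "(g * cf_ratio u (Suc b)) powr (3/4) = g powr (3/4) * cf_ratio u (Suc b) powr (3/4)"
      using g pos[of b] by (simp add: powr_mult)
    also have "4 * \<epsilon> * (g powr (3/4) * cf_ratio u (Suc b) powr (3/4)) \<le> 4 * \<epsilon> * (g powr (3/4) * ?z b)"
      using cf_ratio_powr_le[OF u, of b] \<epsilon> by (intro mult_left_mono) auto
    finally show ?thesis using True by (simp add: f_def mult.assoc ennreal_leI)
  qed simp
  then have "(\<Sum>b. if ok \<or> Suc b < k then ennreal ((g * cf_ratio u (Suc b)) powr (1 - \<epsilon>)) else 0)
      \<le> (\<Sum>b. ennreal (g * f b + 4 * \<epsilon> * g powr (3/4) * ?z b))"
    by (intro suminf_le) auto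
  also have "\<dots> = ennreal (g * S + 4 * \<epsilon> * g powr (3/4) * cf_zeta)"
  proof (rule suminf_ennreal_eq)
    show "0 \<le> g * f b + 4 * \<epsilon> * g powr (3/4) * ?z b" for b
      using g pos[of b] \<epsilon> by (auto simp: f_def less_imp_le intro!: add_nonneg_nonneg mult_nonneg_nonneg)
    show "(\<lambda>b. g * f b + 4 * \<epsilon> * g powr (3/4) * ?z b) sums (g * S + 4 * \<epsilon> * g powr (3/4) * cf_zeta)"
      by (intro sums_add sums_mult S cf_zeta_sums)
  qed
  also have "\<dots> \<le> ennreal (g * (if ok then 1 else 1 - 1 / real k) + 4 * \<epsilon> * g powr (3/4) * cf_zeta)"
    using S(2) g by (intro ennreal_leI add_mono order_refl mult_left_mono[OF _ less_imp_le])
  finally show ?thesis .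
qed

text \<open>One of the partial quotients \<open>1\<close> and \<open>2\<close> is excluded from \<open>ok\<close>; it carries mass at least
  \<open>1/6\<close>, of which the proportion \<open>1/k\<close> is lost.\<close>

lemma cf_ratio_block_sum_le:
  assumes u: "0 \<le> u" "u \<le> 1" and \<epsilon>: "0 \<le> \<epsilon>" "\<epsilon> \<le> 1/4" and k: "0 < k"
    and ok: "\<not> ok 1 \<or> \<not> ok 2"
  shows "(\<Sum>a. \<Sum>b. if ok (Suc a) \<or> Suc b < k
      then ennreal ((cf_ratio u (Suc a) * cf_ratio (1 / (real (Suc a) + u)) (Suc b)) powr (1 - \<epsilon>)) else 0)
    \<le> ennreal (1 - 1 / (6 * real k) + 4 * \<epsilon> * cf_zeta\<^sup>2)"
proof -
  let ?z = "\<lambda>n. 2 * real (Suc n) powr (- (3/2))"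
  obtain a0 where a0: "a0 \<in> {0, 1}" "\<not> ok (Suc a0)" using ok by (auto simp: numeral_2_eq_2)
  have pos: "0 < cf_ratio u (Suc a)" for a using cf_ratio_pos u by simp
  have k1: "1 / real k \<le> 1" using k by simp
  have zeta: "0 \<le> cf_zeta" unfolding cf_zeta_def by (intro suminf_nonneg summable_powr_three_halves) simp
  define d where "d = (\<lambda>a. if a = a0 then 1 / (6 * real k) else 0)"
  define T where "T = (\<lambda>a. cf_ratio u (Suc a) - d a + 4 * \<epsilon> * cf_zeta * ?z a)"
  have le: "cf_ratio u (Suc a) * (if ok (Suc a) then 1 else 1 - 1 / real k)
      + 4 * \<epsilon> * cf_ratio u (Suc a) powr (3/4) * cf_zeta \<le> T a" for a
  proof -
    have "cf_ratio u (Suc a) * (if ok (Suc a) then 1 else 1 - 1 / real k) \<le> cf_ratio u (Suc a) - d a"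
    proof (cases "a = a0")
      case True
      have "1 / 6 \<le> cf_ratio u (Suc a0)" using a0(1) u by (intro cf_ratio_ge_sixth) auto
      then have "1 / 6 * (1 / real k) \<le> cf_ratio u (Suc a0) * (1 / real k)" by (intro mult_right_mono) auto
      then show ?thesis using True a0(2) by (simp add: d_def algebra_simps)
    next
      case False
      have "cf_ratio u (Suc a) * (if ok (Suc a) then 1 else 1 - 1 / real k) \<le> cf_ratio u (Suc a) * 1"
        using pos[of a] k1 by (intro mult_left_mono) auto
      then show ?thesis using False by (simp add: d_def)
    qed
    moreover have "4 * \<epsilon> * cf_ratio u (Suc a) powr (3/4) * cf_zeta \<le> 4 * \<epsilon> * ?z a * cf_zeta"
      using cf_ratio_powr_le[OF u, of a] \<epsilon> zeta by (intro mult_left_mono mult_right_mono) auto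
    ultimately show ?thesis by (simp add: T_def mult_ac)
  qed
  have nonneg: "0 \<le> cf_ratio u (Suc a) * (if ok (Suc a) then 1 else 1 - 1 / real k)
      + 4 * \<epsilon> * cf_ratio u (Suc a) powr (3/4) * cf_zeta" for a
    using pos[of a] k1 \<epsilon> zeta by (intro add_nonneg_nonneg mult_nonneg_nonneg) auto
  have "(\<Sum>b. if ok (Suc a) \<or> Suc b < k
      then ennreal ((cf_ratio u (Suc a) * cf_ratio (1 / (real (Suc a) + u)) (Suc b)) powr (1 - \<epsilon>)) else 0)
    \<le> ennreal (T a)" for a
  proof -
    have "0 \<le> 1 / (real (Suc a) + u)" "1 / (real (Suc a) + u) \<le> 1" using u by auto
    from cf_ratio_inner_sum_le[OF this pos[of a] \<epsilon> k, of "ok (Suc a)"]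
    show ?thesis using le[of a] by (meson ennreal_leI order_trans)
  qed
  then have "(\<Sum>a. \<Sum>b. if ok (Suc a) \<or> Suc b < k
      then ennreal ((cf_ratio u (Suc a) * cf_ratio (1 / (real (Suc a) + u)) (Suc b)) powr (1 - \<epsilon>)) else 0)
    \<le> (\<Sum>a. ennreal (T a))"
    by (intro suminf_le) auto
  also have "\<dots> = ennreal (1 - 1 / (6 * real k) + 4 * \<epsilon> * cf_zeta * cf_zeta)"
  proof (rule suminf_ennreal_eq)
    show "0 \<le> T a" for a using nonneg[of a] le[of a] by linarith
    have "d sums (1 / (6 * real k))" unfolding d_def by (rule sums_single)
    then show "T sums (1 - 1 / (6 * real k) + 4 * \<epsilon> * cf_zeta * cf_zeta)"
      unfolding T_def by (intro sums_add sums_diff sums_mult cf_ratio_sums[OF u(1)] cf_zeta_sums)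
  qed
  finally show ?thesis by (simp add: power2_eq_square mult.assoc)
qed

text \<open>The irrational numbers whose continued fraction expansion passes through two successive
  convergents \<open>r/s\<close> and \<open>p/q\<close>, the latter being a lower one.\<close>

definition cf_cell :: "int \<Rightarrow> int \<Rightarrow> int \<Rightarrow> int \<Rightarrow> real set" where
  "cf_cell p q r s = {x. x \<notin> \<rat> \<and> 0 < of_int q * x - of_int p \<and>
     of_int q * x - of_int p < of_int r - of_int s * x}"

text \<open>The cell lies between the convergent p/q and the mediant (p + r)/(q + s), whose distance
  is 1/(q (q + s)) by determinant 1.\<close>

lemma cf_cell_diameter:
  assumes "0 < q" "0 \<le> s" "q * r - p * s = 1"
  shows "bounded (cf_cell p q r s)" "diameter (cf_cell p q r s) \<le> 1 / (of_int q * of_int (q + s))"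
proof -
  have sub: "cf_cell p q r s \<subseteq> {of_int p / of_int q .. of_int (p + r) / of_int (q + s)}"
    using assms by (auto simp: cf_cell_def field_simps)
  have bnd: "bounded {of_int p / of_int q .. of_int (p + r) / real_of_int (q + s)}" by simp
  show "bounded (cf_cell p q r s)" using bounded_subset[OF bnd sub] .
  have "real_of_int q * of_int r - of_int p * of_int s = of_int (q * r - p * s)" by simp
  then have det: "real_of_int q * of_int r - of_int p * of_int s = 1" using assms(3) by simp
  have len: "of_int (p + r) / of_int (q + s) - of_int p / of_int q
      = 1 / (real_of_int q * of_int (q + s))"
    unfolding det[symmetric] using assms(1,2) by (simp add: divide_simps) (simp add: algebra_simps)
  have le: "of_int p / of_int q \<le> of_int (p + r) / real_of_int (q + s)"
  proof -
    have "0 \<le> 1 / (real_of_int q * of_int (q + s))" using assms by simp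
    then show ?thesis using len by linarith
  qed
  have "diameter (cf_cell p q r s) \<le> diameter {of_int p / of_int q .. of_int (p + r) / real_of_int (q + s)}"
    by (rule diameter_subset[OF sub bnd])
  also have "\<dots> = 1 / (of_int q * of_int (q + s))"
    using le len by (simp add: diameter_closed_interval)
  finally show "diameter (cf_cell p q r s) \<le> 1 / (of_int q * of_int (q + s))" .
qed

text \<open>A step with quotient \<open>Suc a\<close> replaces the denominators (q, s) by (Suc a q +
  s, q). By homogeneity the length changes by a factor that depends on s/q alone.\<close>

lemma cf_cell_length_child:
  fixes q s :: real
  assumes "0 < q" "0 \<le> s"
  shows "1 / ((real (Suc a) * q + s) * (real (Suc a) * q + s + q))
    = 1 / (q * (q + s)) * cf_ratio (s / q) (Suc a)"
proof -
  have "1 + s / q = (q + s) / q" "real (Suc a) + s / q = (real (Suc a) * q + s) / q"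
    "real (Suc a) + 1 + s / q = (real (Suc a) * q + s + q) / q"
    using assms by (simp_all add: field_simps)
  moreover have "q + s \<noteq> 0" using assms by simp
  ultimately show ?thesis using assms(1) by (simp add: cf_ratio_def del: of_nat_Suc)
qed

text \<open>The quotients of the Euclidean algorithm for \<open>q x - p\<close> and \<open>r - s x\<close> give the next two
  convergents, the first of which is an upper one.\<close>

lemma cf_cell_descend:
  fixes p q r s :: int
  assumes q: "0 < q" "0 \<le> s" and x: "x \<in> cf_cell p q r s"
  obtains a b P q1 where "P = int (Suc a) * p + r" "q1 = int (Suc a) * q + s" "q \<le> q1"
    "x \<in> cf_cell (int (Suc b) * P + p) (int (Suc b) * q1 + q) P q1"
    "0 < of_int P - of_int q1 * x"
    "real (Suc b) * (of_int P - of_int q1 * x) \<le> of_int q * x - of_int p"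
proof -
  define X Y where "X = of_int q * x - of_int p" and "Y = of_int r - of_int s * x"
  have irr: "x \<notin> \<rat>" and XY: "0 < X" "X < Y" using x by (auto simp: cf_cell_def X_def Y_def)
  \<comment> \<open>Irrationality makes every remainder nonzero, so the Euclidean algorithm never
    stops.\<close>
  have nz: "of_int i * x - of_int j \<noteq> 0" if "i \<noteq> 0" for i j :: int
  proof
    assume "of_int i * x - of_int j = 0"
    then have "x = of_int j / of_int i" using that by (simp add: field_simps)
    then show False using irr by simp
  qed
  \<comment> \<open>Division with remainder in the reals; as \<open>u < v\<close>, the quotient is
    at least 1 and can be written \<open>Suc n\<close>.\<close>
  have eu: "\<exists>n. v - real (Suc n) * u \<ge> 0 \<and> v - real (Suc n) * u < u" if "0 < u" "u < v" for u v :: real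
  proof -
    define n where "n = nat (\<lfloor>v / u\<rfloor> - 1)"
    have "1 \<le> v / u" using that by simp
    then have "1 \<le> \<lfloor>v / u\<rfloor>" by simp
    then have n: "real (Suc n) = of_int \<lfloor>v / u\<rfloor>" by (simp add: n_def)
    have "real (Suc n) \<le> v / u" "v / u < real (Suc n) + 1" unfolding n by linarith+
    then have "real (Suc n) * u \<le> v" "v < (real (Suc n) + 1) * u"
      using that by (simp_all add: pos_le_divide_eq pos_divide_less_eq)
    then show ?thesis by (intro exI[of _ n]) (simp add: algebra_simps)
  qed
  obtain a where a: "0 \<le> Y - real (Suc a) * X" "Y - real (Suc a) * X < X" using eu[OF XY] by blast
  define P q1 where "P = int (Suc a) * p + r" and "q1 = int (Suc a) * q + s"
  define X' where "X' = of_int P - of_int q1 * x"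
  have X'Y: "X' = Y - real (Suc a) * X"
    by (simp add: X'_def X_def Y_def P_def q1_def algebra_simps)
  have "1 * q \<le> int (Suc a) * q" using q by (intro mult_right_mono) auto
  then have q1: "q \<le> q1" using q(2) unfolding q1_def mult_1 by linarith
  have "X' \<noteq> 0" using nz[of q1 P] q1 q by (simp add: X'_def)
  then have X': "0 < X'" "X' < X" using a X'Y by auto
  obtain b where b: "0 \<le> X - real (Suc b) * X'" "X - real (Suc b) * X' < X'" using eu[OF X'] by blast
  define p2 q2 where "p2 = int (Suc b) * P + p" and "q2 = int (Suc b) * q1 + q"
  have X2: "X - real (Suc b) * X' = of_int q2 * x - of_int p2"
    by (simp add: X'_def X_def p2_def q2_def algebra_simps)
  have "0 < q2" unfolding q2_def using q q1 by (intro add_nonneg_pos mult_nonneg_nonneg) auto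
  then have "of_int q2 * x - of_int p2 \<noteq> 0" by (intro nz) simp
  then have mem: "x \<in> cf_cell p2 q2 P q1"
    using b irr unfolding X2 by (auto simp: cf_cell_def X'_def)
  show ?thesis
    using that[OF P_def q1_def q1, of b] mem X' b unfolding p2_def q2_def X'_def X_def by simp
qed

text \<open>The intermediate upper convergent is too close to \<open>x\<close> if \<open>b \<ge> k\<close>.\<close>

lemma cf_cell_cover:
  fixes p q r s :: int
  assumes q: "0 < q" "0 \<le> s" "int Q \<le> q" and det: "q * r - p * s = 1"
    and x: "x \<in> cf_cell p q r s" "x \<in> no_close_upper k Q"
  obtains a b where "int k dvd int (Suc a) * q + s \<or> Suc b < k"
    "x \<in> cf_cell (int (Suc b) * (int (Suc a) * p + r) + p) (int (Suc b) * (int (Suc a) * q + s) + q)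
      (int (Suc a) * p + r) (int (Suc a) * q + s)"
proof -
  obtain a b P q1 where P_def: "P = int (Suc a) * p + r" and q1_def: "q1 = int (Suc a) * q + s"
    and q1: "q \<le> q1" and mem: "x \<in> cf_cell (int (Suc b) * P + p) (int (Suc b) * q1 + q) P q1"
    and X'0: "0 < of_int P - of_int q1 * x"
    and bX: "real (Suc b) * (of_int P - of_int q1 * x) \<le> of_int q * x - of_int p"
    using cf_cell_descend[OF q(1,2) x(1)] by metis
  define X X' where "X = of_int q * x - of_int p" and "X' = of_int P - of_int q1 * x"
  have X': "0 < X'" and b: "real (Suc b) * X' \<le> X" using X'0 bX by (auto simp: X_def X'_def)
  have det1: "q * P - p * q1 = 1" using det by (simp add: P_def q1_def algebra_simps)
  have "int k dvd q1 \<or> Suc b < k"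
  proof (rule ccontr)
    assume H: "\<not> (int k dvd q1 \<or> Suc b < k)"
    then have kb: "real k \<le> real (Suc b)" by simp
    have "coprime P q1"
    proof (rule coprimeI)
      fix d assume "d dvd P" "d dvd q1"
      then have "d dvd q * P - p * q1" by simp
      then show "is_unit d" unfolding det1 .
    qed
    then have "\<not> (0 < X' \<and> of_int q1 * X' * real k < 1)"
      using x(2) H q1 q(3) unfolding no_close_upper_def X'_def by force
    moreover have "of_int q1 * X' * real k < 1"
    proof -
      \<comment> \<open>The determinant, expressed by the two remainders, is q1 X + q X' = 1. Since
        X' k \<le> X' (b + 1) \<le> X, the product q1 X' k is at most q1 X < 1.\<close>
      have "real_of_int (q * P - p * q1) = of_int q1 * X + of_int q * X'"
        by (simp add: X_def X'_def algebra_simps)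
      then have "of_int q1 * X + of_int q * X' = 1" unfolding det1 by simp
      moreover have "0 < of_int q * X'" using q X' by simp
      ultimately have "of_int q1 * X < 1" by linarith
      moreover have "of_int q1 * X' * real k \<le> of_int q1 * X"
      proof -
        have "X' * real k \<le> X' * real (Suc b)" using kb X' by (intro mult_left_mono) auto
        also have "\<dots> \<le> X" using b by (simp add: mult.commute del: of_nat_Suc)
        finally have "of_int q1 * (X' * real k) \<le> of_int q1 * X" using q q1 by (intro mult_left_mono) auto
        then show ?thesis by (simp add: mult.assoc)
      qed
      ultimately show ?thesis by linarith
    qed
    ultimately show False using X' by blast
  qed
  then show ?thesis using that mem unfolding P_def q1_def by blast
qed

text \<open>Induction on the number \<open>n\<close> of two-step blocks: the admissible
  grandchildren of a cell cover it, and their lengths to the power \<open>1 - \<epsilon>\<close> add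
  up to at most \<theta> times that of the cell. Determinant 1 and \<open>Q \<le> q\<close> pass to
  the grandchildren, so the estimate iterates.\<close>

lemma hausdorff_premeasure_cf_cell_le:
  fixes p q r s :: int
  assumes k: "2 \<le> k" and \<epsilon>: "0 \<le> \<epsilon>" "\<epsilon> \<le> 1/4"
    and \<theta>: "1 - 1 / (6 * real k) + 4 * \<epsilon> * cf_zeta\<^sup>2 \<le> \<theta>"
  shows "0 < q \<Longrightarrow> 0 \<le> s \<Longrightarrow> s \<le> q \<Longrightarrow> int Q \<le> q \<Longrightarrow> q * r - p * s = 1 \<Longrightarrow>
    hausdorff_premeasure (1 - \<epsilon>) 1 (no_close_upper k Q \<inter> cf_cell p q r s)
      \<le> ennreal (\<theta> ^ n * (1 / (of_int q * of_int (q + s))) powr (1 - \<epsilon>))"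
proof (induction n arbitrary: p q r s)
  case 0
  have "1 \<le> real_of_int q" "1 \<le> real_of_int (q + s)" using 0 by auto
  then have "1 * 1 \<le> real_of_int q * of_int (q + s)" by (intro mult_mono) auto
  then have "1 / (real_of_int q * of_int (q + s)) \<le> 1" by simp
  then have "hausdorff_premeasure (1 - \<epsilon>) 1 (cf_cell p q r s)
      \<le> ennreal ((1 / (of_int q * of_int (q + s))) powr (1 - \<epsilon>))"
    using cf_cell_diameter[OF 0(1,2,5)] \<epsilon> by (intro hausdorff_premeasure_le_single) auto
  then show ?case
    using hausdorff_premeasure_mono[of "no_close_upper k Q \<inter> cf_cell p q r s" "cf_cell p q r s" "1 - \<epsilon>" 1]
    by simp
next
  case (Suc n)
  define L where "L = 1 / (real_of_int q * of_int (q + s))"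
  define u where "u = real_of_int s / of_int q"
  have u: "0 \<le> u" "u \<le> 1" using Suc.prems by (auto simp: u_def)
  have L: "0 < L" using Suc.prems by (simp add: L_def)
  have "0 \<le> 1 - 1 / (6 * real k) + 4 * \<epsilon> * cf_zeta\<^sup>2"
    using k \<epsilon> by (simp add: divide_le_eq add_nonneg_nonneg)
  then have \<theta>0: "0 \<le> \<theta>" using \<theta> by linarith
  \<comment> \<open>If \<open>k\<close> divides the denominator of the upper convergent belonging to
    \<open>a\<close>, that convergent imposes no condition on the next quotient.\<close>
  define ok where "ok = (\<lambda>a. int k dvd int a * q + s)"
  define C where "C = (\<lambda>a b. no_close_upper k Q \<inter>
    cf_cell (int (Suc b) * (int (Suc a) * p + r) + p) (int (Suc b) * (int (Suc a) * q + s) + q)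
      (int (Suc a) * p + r) (int (Suc a) * q + s))"
  define G where "G = (\<lambda>a b. cf_ratio u (Suc a) * cf_ratio (1 / (real (Suc a) + u)) (Suc b))"
  have "no_close_upper k Q \<inter> cf_cell p q r s
      \<subseteq> (\<Union>a. \<Union>b. if ok (Suc a) \<or> Suc b < k then C a b else {})"
  proof
    fix x assume x: "x \<in> no_close_upper k Q \<inter> cf_cell p q r s"
    obtain a b where "int k dvd int (Suc a) * q + s \<or> Suc b < k"
      "x \<in> cf_cell (int (Suc b) * (int (Suc a) * p + r) + p) (int (Suc b) * (int (Suc a) * q + s) + q)
        (int (Suc a) * p + r) (int (Suc a) * q + s)"
      using cf_cell_cover[OF Suc.prems(1,2,4,5), of x k] x by auto
    then have "x \<in> (if ok (Suc a) \<or> Suc b < k then C a b else {})"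
      using x by (auto simp: ok_def C_def)
    then show "x \<in> (\<Union>a. \<Union>b. if ok (Suc a) \<or> Suc b < k then C a b else {})" by blast
  qed
  then have "hausdorff_premeasure (1 - \<epsilon>) 1 (no_close_upper k Q \<inter> cf_cell p q r s)
      \<le> hausdorff_premeasure (1 - \<epsilon>) 1 (\<Union>a. \<Union>b. if ok (Suc a) \<or> Suc b < k then C a b else {})"
    by (rule hausdorff_premeasure_mono)
  also have "\<dots> \<le> (\<Sum>a. hausdorff_premeasure (1 - \<epsilon>) 1 (\<Union>b. if ok (Suc a) \<or> Suc b < k then C a b else {}))"
    by (rule hausdorff_premeasure_UN_le)
  also have "\<dots> \<le> (\<Sum>a. \<Sum>b. hausdorff_premeasure (1 - \<epsilon>) 1 (if ok (Suc a) \<or> Suc b < k then C a b else {}))"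
    by (intro suminf_le hausdorff_premeasure_UN_le) auto
  also have "\<dots> \<le> (\<Sum>a. \<Sum>b. ennreal (\<theta> ^ n * L powr (1 - \<epsilon>)) *
      (if ok (Suc a) \<or> Suc b < k then ennreal (G a b powr (1 - \<epsilon>)) else 0))"
  proof (intro suminf_le)
    fix a b
    define P1 q1 where "P1 = int (Suc a) * p + r" and "q1 = int (Suc a) * q + s"
    define p2 q2 where "p2 = int (Suc b) * P1 + p" and "q2 = int (Suc b) * q1 + q"
    have "1 * q \<le> int (Suc a) * q" using Suc.prems by (intro mult_right_mono) auto
    then have q1: "q \<le> q1" using Suc.prems(2) unfolding q1_def mult_1 by linarith
    have "1 * q1 \<le> int (Suc b) * q1" using Suc.prems q1 by (intro mult_right_mono) auto
    then have q2: "q1 + q \<le> q2" unfolding q2_def mult_1 by linarith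
    have det2: "q2 * P1 - p2 * q1 = 1"
      using Suc.prems(5) by (simp add: p2_def q2_def P1_def q1_def algebra_simps)
    have IH: "hausdorff_premeasure (1 - \<epsilon>) 1 (no_close_upper k Q \<inter> cf_cell p2 q2 P1 q1)
      \<le> ennreal (\<theta> ^ n * (1 / (of_int q2 * of_int (q2 + q1))) powr (1 - \<epsilon>))"
      by (rule Suc.IH) (use Suc.prems q1 q2 det2 in auto)
    have "1 / (real_of_int q2 * of_int (q2 + q1)) = L * G a b"
    proof -
      have r1: "real_of_int q1 = real (Suc a) * of_int q + of_int s"
        by (simp add: q1_def)
      have r2: "real_of_int q2 = real (Suc b) * of_int q1 + of_int q" by (simp add: q2_def)
      have pos: "0 < real_of_int q" "0 \<le> real_of_int s" "0 < real_of_int q1"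
        using Suc.prems q1 by auto
      have "1 / (real_of_int q2 * of_int (q2 + q1))
        = 1 / (of_int q1 * (of_int q1 + of_int q)) * cf_ratio (of_int q / of_int q1) (Suc b)"
        using cf_cell_length_child[OF pos(3) less_imp_le[OF pos(1)], of b] unfolding r2[symmetric] by simp
      also have "1 / (real_of_int q1 * (of_int q1 + of_int q)) = L * cf_ratio u (Suc a)"
        using cf_cell_length_child[OF pos(1,2), of a] unfolding r1[symmetric] L_def u_def by simp
      also have "of_int q / of_int q1 = 1 / (real (Suc a) + u)"
        unfolding r1 u_def using pos by (simp add: divide_simps)
      finally show ?thesis by (simp add: G_def mult.assoc)
    qed
    then have eq: "\<theta> ^ n * (1 / (of_int q2 * of_int (q2 + q1))) powr (1 - \<epsilon>)
        = (\<theta> ^ n * L powr (1 - \<epsilon>)) * G a b powr (1 - \<epsilon>)"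
      using L by (simp add: powr_mult)
    have "ennreal (\<theta> ^ n * (1 / (of_int q2 * of_int (q2 + q1))) powr (1 - \<epsilon>))
        = ennreal (\<theta> ^ n * L powr (1 - \<epsilon>)) * ennreal (G a b powr (1 - \<epsilon>))"
      unfolding eq using \<theta>0 by (intro ennreal_mult) auto
    then show "hausdorff_premeasure (1 - \<epsilon>) 1 (if ok (Suc a) \<or> Suc b < k then C a b else {})
        \<le> ennreal (\<theta> ^ n * L powr (1 - \<epsilon>)) *
          (if ok (Suc a) \<or> Suc b < k then ennreal (G a b powr (1 - \<epsilon>)) else 0)"
      using IH by (simp add: C_def p2_def q2_def P1_def q1_def del: of_nat_Suc)
  qed auto
  also have "\<dots> = ennreal (\<theta> ^ n * L powr (1 - \<epsilon>)) * (\<Sum>a. \<Sum>b.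
      if ok (Suc a) \<or> Suc b < k then ennreal (G a b powr (1 - \<epsilon>)) else 0)"
    by simp
  also have "\<dots> \<le> ennreal (\<theta> ^ n * L powr (1 - \<epsilon>)) * ennreal \<theta>"
  proof (rule mult_left_mono)
    \<comment> \<open>Divisibility for both quotients gives, by subtraction, that \<open>k\<close>
      divides \<open>q\<close> and then \<open>s\<close>, against determinant 1.\<close>
    have "\<not> ok 1 \<or> \<not> ok 2"
    proof (rule ccontr)
      assume "\<not> (\<not> ok 1 \<or> \<not> ok 2)"
      then have d: "int k dvd q + s" "int k dvd 2 * q + s" by (auto simp: ok_def)
      then have "int k dvd (2 * q + s) - (q + s)" by (rule dvd_diff[rotated])
      then have dq: "int k dvd q" by simp
      then have "int k dvd (q + s) - q" using d by (intro dvd_diff) auto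
      then have "int k dvd s" by simp
      then have "int k dvd q * r - p * s" using dq by simp
      then show False using Suc.prems(5) k by simp
    qed
    moreover have "0 < k" using k by simp
    ultimately have "(\<Sum>a. \<Sum>b. if ok (Suc a) \<or> Suc b < k then ennreal (G a b powr (1 - \<epsilon>)) else 0)
        \<le> ennreal (1 - 1 / (6 * real k) + 4 * \<epsilon> * cf_zeta\<^sup>2)"
      unfolding G_def by (intro cf_ratio_block_sum_le u \<epsilon>)
    also have "\<dots> \<le> ennreal \<theta>" by (rule ennreal_leI[OF \<theta>])
    finally show "(\<Sum>a. \<Sum>b. if ok (Suc a) \<or> Suc b < k then ennreal (G a b powr (1 - \<epsilon>)) else 0) \<le> ennreal \<theta>" .
  qed simp
  also have "\<dots> = ennreal (\<theta> ^ Suc n * L powr (1 - \<epsilon>))"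
    using \<theta>0 by (subst ennreal_mult[symmetric]) (auto simp: mult_ac)
  finally show ?case by (simp add: L_def)
qed

text \<open>The start is the pair of floor(x)/1 and the formal fraction 1/0; each pair of steps
  enlarges the denominator, which therefore passes any \<open>Q\<close>.\<close>

lemma irrational_in_cf_cell:
  assumes "x \<notin> \<rat>"
  shows "\<exists>p q r s. 0 < q \<and> 0 \<le> s \<and> s \<le> q \<and> int Q \<le> q \<and> q * r - p * s = 1 \<and> x \<in> cf_cell p q r s"
proof (induction Q)
  case 0
  have "x \<noteq> of_int \<lfloor>x\<rfloor>" using assms Rats_of_int by metis
  then have "0 < x - of_int \<lfloor>x\<rfloor>" "x - of_int \<lfloor>x\<rfloor> < 1" by linarith+
  then have "x \<in> cf_cell \<lfloor>x\<rfloor> 1 1 0" using assms by (simp add: cf_cell_def)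
  then show ?case by (intro exI[of _ "\<lfloor>x\<rfloor>"] exI[of _ "1::int"] exI[of _ "0::int"]) auto
next
  case (Suc Q)
  then obtain p q r s where *: "0 < q" "0 \<le> s" "s \<le> q" "int Q \<le> q" "q * r - p * s = 1" "x \<in> cf_cell p q r s"
    by blast
  obtain a b P q1 where P: "P = int (Suc a) * p + r" "q1 = int (Suc a) * q + s" "q \<le> q1"
    "x \<in> cf_cell (int (Suc b) * P + p) (int (Suc b) * q1 + q) P q1"
    using cf_cell_descend[OF *(1,2,6)] by metis
  define p2 q2 where "p2 = int (Suc b) * P + p" and "q2 = int (Suc b) * q1 + q"
  have "1 * q1 \<le> int (Suc b) * q1" using *(1) P(3) by (intro mult_right_mono) auto
  then have "q1 + q \<le> q2" unfolding q2_def mult_1 by linarith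
  then have "0 < q2" "0 \<le> q1" "q1 \<le> q2" "int (Suc Q) \<le> q2" using P(3) *(1,4) by linarith+
  moreover have "q2 * P - p2 * q1 = 1"
    using *(5) by (simp add: P p2_def q2_def algebra_simps)
  moreover have "x \<in> cf_cell p2 q2 P q1" using P(4) by (simp only: p2_def q2_def)
  ultimately show ?case by blast
qed

lemma no_close_upper_null:
  assumes k: "2 \<le> k"
  obtains t where "0 < t" "t < 1"
    "\<And>Q. hausdorff_premeasure t 1 (no_close_upper k Q - \<rat>) = 0"
proof -
  \<comment> \<open>The error of the lowered exponent may use up half of the gain 1/(6 k), which
    leaves \<theta> = 1 - 1/(12 k). The added 1 keeps the denominator positive.\<close>
  define \<epsilon> where "\<epsilon> = min (1/4) (1 / (48 * real k * (cf_zeta\<^sup>2 + 1)))"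
  define \<theta> where "\<theta> = 1 - 1 / (12 * real k)"
  have pos: "0 < 48 * real k * (cf_zeta\<^sup>2 + 1)" using k by (intro mult_pos_pos) (auto simp: add_nonneg_pos)
  have \<epsilon>: "0 < \<epsilon>" "\<epsilon> \<le> 1/4" using pos by (auto simp: \<epsilon>_def)
  have "4 * \<epsilon> * cf_zeta\<^sup>2 \<le> 4 * \<epsilon> * (cf_zeta\<^sup>2 + 1)" using \<epsilon> by (intro mult_left_mono) auto
  also have "\<dots> \<le> 4 * (1 / (48 * real k * (cf_zeta\<^sup>2 + 1))) * (cf_zeta\<^sup>2 + 1)"
    by (intro mult_right_mono mult_left_mono) (auto simp: \<epsilon>_def)
  also have "\<dots> = 1 / (12 * real k)"
  proof -
    have "cf_zeta\<^sup>2 + 1 \<noteq> 0" using zero_le_power2[of cf_zeta] by linarith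
    then show ?thesis using k by (simp add: divide_simps)
  qed
  finally have \<theta>: "1 - 1 / (6 * real k) + 4 * \<epsilon> * cf_zeta\<^sup>2 \<le> \<theta>"
    using k by (simp add: \<theta>_def field_simps)
  have \<theta>01: "0 \<le> \<theta>" "\<theta> < 1" using k by (auto simp: \<theta>_def divide_le_eq)
  have cell: "hausdorff_premeasure (1 - \<epsilon>) 1 (no_close_upper k Q \<inter> cf_cell p q r s) = 0"
    if H: "0 < q" "0 \<le> s" "s \<le> q" "int Q \<le> q" "q * r - p * s = 1" for Q p q r s
  proof -
    define L where "L = (1 / (real_of_int q * of_int (q + s))) powr (1 - \<epsilon>)"
    have "hausdorff_premeasure (1 - \<epsilon>) 1 (no_close_upper k Q \<inter> cf_cell p q r s) \<le> ennreal (\<theta> ^ n * L)" for n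
      unfolding L_def using hausdorff_premeasure_cf_cell_le[OF k less_imp_le[OF \<epsilon>(1)] \<epsilon>(2) \<theta> H] .
    moreover have "(\<lambda>n. ennreal (\<theta> ^ n * L)) \<longlonglongrightarrow> ennreal (0 * L)"
      using \<theta>01 by (intro tendsto_ennrealI tendsto_mult LIMSEQ_power_zero tendsto_const) auto
    ultimately have "hausdorff_premeasure (1 - \<epsilon>) 1 (no_close_upper k Q \<inter> cf_cell p q r s) \<le> ennreal (0 * L)"
      by (intro LIMSEQ_le_const) auto
    then show ?thesis by simp
  qed
  have "hausdorff_premeasure (1 - \<epsilon>) 1 (no_close_upper k Q - \<rat>) = 0" for Q
  proof -
    define I where "I = {(p, q, r, s). 0 < q \<and> 0 \<le> s \<and> s \<le> q \<and> int Q \<le> q \<and> q * r - p * s = (1::int)}"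
    have "hausdorff_premeasure (1 - \<epsilon>) 1 (\<Union>i\<in>I. no_close_upper k Q \<inter> (case i of (p, q, r, s) \<Rightarrow> cf_cell p q r s)) = 0"
      using cell by (intro hausdorff_premeasure_null_UN) (auto simp: I_def)
    moreover have "no_close_upper k Q - \<rat> \<subseteq> (\<Union>i\<in>I. no_close_upper k Q \<inter> (case i of (p, q, r, s) \<Rightarrow> cf_cell p q r s))"
    proof
      fix x assume x: "x \<in> no_close_upper k Q - \<rat>"
      then obtain p q r s where "0 < q \<and> 0 \<le> s \<and> s \<le> q \<and> int Q \<le> q \<and> q * r - p * s = 1 \<and> x \<in> cf_cell p q r s"
        using irrational_in_cf_cell[of x Q] by blast
      then show "x \<in> (\<Union>i\<in>I. no_close_upper k Q \<inter> (case i of (p, q, r, s) \<Rightarrow> cf_cell p q r s))"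
        using x by (intro UN_I[of "(p, q, r, s)"]) (auto simp: I_def)
    qed
    ultimately show ?thesis using hausdorff_premeasure_mono by (metis le_zero_eq)
  qed
  then show ?thesis using that[of "1 - \<epsilon>"] \<epsilon> by auto
qed

subsection \<open>Sufficient conditions for boundedness from below\<close>

lemma le_nat_floor_iff: "0 \<le> x \<Longrightarrow> j \<le> nat \<lfloor>x\<rfloor> \<longleftrightarrow> real j \<le> x"
  by (metis le_nat_iff le_floor_iff of_int_of_nat_eq zero_le_floor)

lemma irrational_mult_of_nat_neq:
  fixes y z :: real
  assumes "y \<notin> \<rat>" "z \<in> \<rat>" "0 < z"
  shows "real j \<noteq> z * y"
proof
  assume "real j = z * y"
  then have "y = real j / z" using assms(3) by simp
  then show False using assms Rats_divide Rats_of_nat by metis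
qed

text \<open>Counting along the other lattice direction: with \<open>y = 1/x\<close>, the multiples \<open>j x\<close> with integer
  part \<open>I\<close> are those with \<open>I y < j < (I + 1) y\<close>.\<close>

lemma discrepancy_step:
  fixes y c :: real
  assumes y: "0 < y" "y \<notin> \<rat>" and c: "0 < c" "c < 1" "c \<in> \<rat>"
  shows "discrepancy (1 / y) c (nat \<lfloor>real (Suc I) * y\<rfloor>) + c * real (nat \<lfloor>real (Suc I) * y\<rfloor>)
    = discrepancy (1 / y) c (nat \<lfloor>real I * y\<rfloor>) + c * real (nat \<lfloor>real I * y\<rfloor>)
      + real_of_int (\<lfloor>(real I + c) * y\<rfloor> - \<lfloor>real I * y\<rfloor>)"
proof -
  define a where "a = nat \<lfloor>real I * y\<rfloor>"
  define b where "b = nat \<lfloor>real (Suc I) * y\<rfloor>"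
  define e where "e = nat \<lfloor>(real I + c) * y\<rfloor>"
  have ab: "a \<le> b" unfolding a_def b_def e_def using y by (intro nat_mono floor_mono mult_right_mono) auto
  have ae: "a \<le> e" unfolding a_def b_def e_def using y c by (intro nat_mono floor_mono mult_right_mono) auto
  have eb: "e \<le> b" unfolding a_def b_def e_def using y c by (intro nat_mono floor_mono mult_right_mono) auto
  \<comment> \<open>These \<open>j\<close> have \<open>I\<close> as the integer part of j/y, and
    \<open>e\<close> is the last one before the fractional part passes \<open>c\<close>; ties cannot
    occur, as \<open>y\<close> is irrational and \<open>I + c\<close> rational.\<close>
  have ind: "indicat_real {0..<c} (frac (real j * (1 / y))) = (if j \<le> e then 1 else 0)"
    if j: "j \<in> {a<..b}" for j
  proof -
    have 1: "real I * y < real j"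
      using j y le_nat_floor_iff[of "real I * y" j] by (auto simp: a_def b_def e_def)
    have 2: "real j \<le> real (Suc I) * y"
      using j y le_nat_floor_iff[of "real (Suc I) * y" j] by (auto simp: a_def b_def e_def)
    have 3: "real j \<noteq> real (Suc I) * y" "real j \<noteq> (real I + c) * y"
      using irrational_mult_of_nat_neq[OF y(2), of _ j] c by (auto intro!: Rats_add simp: add_nonneg_pos)
    have F: "frac (real j * (1 / y)) = real j / y - real I"
      using 1 2 3 y by (subst frac_unique_iff) (auto simp: field_simps)
    have "frac (real j * (1 / y)) < c \<longleftrightarrow> real j / y < real I + c"
      unfolding F by linarith
    also have "\<dots> \<longleftrightarrow> real j < (real I + c) * y"
      using y by (simp add: pos_divide_less_eq)
    also have "\<dots> \<longleftrightarrow> j \<le> e"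
      using 3 le_nat_floor_iff[of "(real I + c) * y" j] y c by (auto simp: a_def b_def e_def)
    finally show ?thesis using frac_ge_0 by (auto simp: indicator_def)
  qed
  have "{1..b} = {1..a} \<union> {a<..b}" using ab by auto
  then have "(\<Sum>j=1..b. indicat_real {0..<c} (frac (real j * (1 / y))))
    = (\<Sum>j=1..a. indicat_real {0..<c} (frac (real j * (1 / y))))
      + (\<Sum>j\<in>{a<..b}. indicat_real {0..<c} (frac (real j * (1 / y))))"
    by (simp add: sum.union_disjoint ivl_disj_int)
  also have "(\<Sum>j\<in>{a<..b}. indicat_real {0..<c} (frac (real j * (1 / y)))) = (\<Sum>j\<in>{a<..b}. if j \<le> e then 1 else 0)"
    by (intro sum.cong refl ind)
  also have "\<dots> = (\<Sum>j\<in>{a<..e}. 1)"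
    using eb by (intro sum.mono_neutral_cong_right) auto
  also have "\<dots> = real e - real a" using ae by simp
  also have "\<dots> = real_of_int (\<lfloor>(real I + c) * y\<rfloor> - \<lfloor>real I * y\<rfloor>)"
    using y c by (simp add: a_def b_def e_def)
  finally show ?thesis unfolding discrepancy_def a_def b_def e_def by simp
qed

text \<open>Adding \<open>k a\<close> to \<beta> lengthens each run of indices by \<open>k a\<close>
  and, because \<open>c k = h\<close>, its counted part by exactly \<open>h a = c k a\<close>. This
  balance is the reason for partial quotients divisible by \<open>k\<close>.\<close>

lemma discrepancy_renormalize:
  fixes \<beta> :: real and a h k :: nat
  assumes k: "0 < k" and c: "c = real h / real k" "0 < c" "c < 1"
    and \<beta>: "0 < \<beta>" "\<beta> < 1" "\<beta> \<notin> \<rat>"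
  shows "discrepancy (1 / (real (k * a) + \<beta>)) c (nat \<lfloor>real I * (real (k * a) + \<beta>)\<rfloor>)
    = discrepancy (1 / \<beta>) c (nat \<lfloor>real I * \<beta>\<rfloor>)"
proof -
  define y where "y = real (k * a) + \<beta>"
  have y: "0 < y" "y \<notin> \<rat>"
  proof -
    show "0 < y" using \<beta> by (simp add: y_def add_nonneg_pos)
    show "y \<notin> \<rat>"
    proof
      assume "y \<in> \<rat>"
      then have "y - real (k * a) \<in> \<rat>" by (intro Rats_diff) auto
      with \<beta> show False by (simp add: y_def)
    qed
  qed
  have cR: "c \<in> \<rat>" using c by simp
  have Iy: "\<lfloor>real I * y\<rfloor> = int (I * (k * a)) + \<lfloor>real I * \<beta>\<rfloor>" for I
  proof -
    have "real I * y = of_int (int (I * (k * a))) + real I * \<beta>" by (simp add: y_def algebra_simps)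
    then show ?thesis by (metis floor_add_int add.commute)
  qed
  have Icy: "\<lfloor>(real I + c) * y\<rfloor> = int (I * (k * a) + h * a) + \<lfloor>(real I + c) * \<beta>\<rfloor>" for I
  proof -
    have "(real I + c) * y = of_int (int (I * (k * a) + h * a)) + (real I + c) * \<beta>"
      using k c by (simp add: y_def algebra_simps)
    then show ?thesis by (metis floor_add_int add.commute)
  qed
  have nI: "real (nat \<lfloor>real I * y\<rfloor>) = real (I * (k * a)) + real (nat \<lfloor>real I * \<beta>\<rfloor>)" for I
    unfolding Iy using \<beta> by (simp add: nat_add_distrib)
  have ck: "c * real k = real h" using c k by simp
  have "discrepancy (1 / y) c (nat \<lfloor>real I * y\<rfloor>) = discrepancy (1 / \<beta>) c (nat \<lfloor>real I * \<beta>\<rfloor>)"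
  proof (induction I)
    case (Suc I)
    define A B where "A = (\<lambda>I. nat \<lfloor>real I * y\<rfloor>)" and "B = (\<lambda>I. nat \<lfloor>real I * \<beta>\<rfloor>)"
    define G where "G = (\<lambda>I. c * real (I * (k * a)))"
    have "G (Suc I) = G I + real h * real a"
      unfolding ck[symmetric] G_def by (simp add: algebra_simps)
    moreover have "\<lfloor>(real I + c) * y\<rfloor> - \<lfloor>real I * y\<rfloor>
      = int (h * a) + (\<lfloor>(real I + c) * \<beta>\<rfloor> - \<lfloor>real I * \<beta>\<rfloor>)"
      unfolding Icy Iy by simp
    moreover have "c * real (A I) = G I + c * real (B I)" for I
      unfolding A_def B_def G_def nI by (simp add: algebra_simps)
    ultimately show ?case
      using discrepancy_step[OF y c(2,3) cR, of I] discrepancy_step[OF \<beta>(1,3) c(2,3) cR, of I] Suc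
      unfolding A_def[symmetric, THEN fun_cong] B_def[symmetric, THEN fun_cong] by simp
  qed simp
  then show ?thesis by (simp add: y_def)
qed

text \<open>The members have continued fractions whose partial quotients are all positive multiples
  of \<open>k\<close>. Closure of the set under tails replaces sequences of quotients: inductions
  pass from \<open>x\<close> to its tail within \<open>C\<close>.\<close>

definition cf_heavy :: "nat \<Rightarrow> real set \<Rightarrow> bool" where
  "cf_heavy k C \<longleftrightarrow> (\<forall>x\<in>C. 0 < x \<and> x < 1 \<and> (\<exists>a y. 0 < a \<and> y \<in> C \<and> x = 1 / (real (k * a) + y)))"

text \<open>Infinite descent: if x = p/q with 0 < p < q, the tail of \<open>x\<close> has
  denominator p.\<close>

lemma cf_heavy_irrational:
  assumes "0 < k" "cf_heavy k C" "x \<in> C"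
  shows "x \<notin> \<rat>"
proof -
  have "\<forall>x\<in>C. \<forall>p::int. x \<noteq> of_int p / real q" if "0 < q" for q :: nat
    using that
  proof (induction q rule: less_induct)
    case (less q)
    show ?case
    proof (intro ballI allI notI)
      fix x and p :: int assume x: "x \<in> C" "x = of_int p / real q"
      then obtain a y where a: "0 < x" "x < 1" "y \<in> C" "x = 1 / (real (k * a) + y)"
        using assms(2) by (fastforce simp: cf_heavy_def)
      have p: "0 < p" "p < int q" using a(1,2) x less.prems by (auto simp: field_simps)
      have "real (k * a) + y = 1 / x" using a by simp
      then have "y = real q / of_int p - real (k * a)" using x by (simp add: algebra_simps)
      also have "\<dots> = of_int (int q - int (k * a) * p) / real (nat p)"
        using p by (simp add: field_simps)
      finally show False using less.IH[of "nat p"] p a(3) by (metis nat_less_iff zero_less_nat_eq less_imp_le)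
    qed
  qed
  then show ?thesis
    using assms(3) by (metis Rats_cases' of_int_of_nat_eq zero_less_imp_eq_int)
qed

text \<open>Between two consecutive multiples of \<open>1/x\<close> the discrepancy first increases and then decreases,
  so it suffices to bound it at the points \<open>\<lfloor>I/x\<rfloor>\<close>, where two continued fraction steps lead to
  a smaller index.\<close>

lemma cf_heavy_discrepancy_nonneg:
  assumes k: "0 < k" and c: "c = real h / real k" "0 < c" "c < 1"
    and C: "cf_heavy k C" and x: "x \<in> C"
  shows "0 \<le> discrepancy x c N"
  using x
proof (induction N arbitrary: x rule: less_induct)
  case (less N)
  obtain a \<beta> where a: "0 < x" "x < 1" "0 < a" "\<beta> \<in> C" "x = 1 / (real (k * a) + \<beta>)"
    using C less.prems unfolding cf_heavy_def by blast
  obtain a' \<gamma> where b: "0 < \<beta>" "\<beta> < 1" "\<gamma> \<in> C" "\<beta> = 1 / (real (k * a') + \<gamma>)"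
    using C a(4) unfolding cf_heavy_def by blast
  have \<beta>irr: "\<beta> \<notin> \<rat>" and xirr: "x \<notin> \<rat>"
    using cf_heavy_irrational[OF k C] a(4) less.prems by auto
  define y where "y = real (k * a) + \<beta>"
  have y: "0 < y" "x = 1 / y" using a b by (auto simp: y_def add_nonneg_pos)
  have xy: "u * y \<le> v \<longleftrightarrow> u \<le> v * x" "u * y < v \<longleftrightarrow> u < v * x" "v \<le> u * y \<longleftrightarrow> v * x \<le> u" for u v
    using y by (simp_all add: pos_le_divide_eq pos_less_divide_eq pos_divide_le_eq)
  have "1 \<le> k * a" using k a by simp
  then have ka: "1 \<le> real (k * a)" by linarith
  \<comment> \<open>Renormalization leads to 1/\<beta>, which differs from \<gamma> by the integer
    \<open>k a'\<close>. The index becomes floor(I \<beta>), and the induction hypothesis applies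
    once this is below \<open>N\<close>.\<close>
  have key: "0 \<le> discrepancy x c (nat \<lfloor>real I * y\<rfloor>)" if "real I * \<beta> < real N" for I
  proof -
    have "nat \<lfloor>real I * \<beta>\<rfloor> < N" using that b by (simp add: nat_less_iff floor_less_iff)
    then have "0 \<le> discrepancy \<gamma> c (nat \<lfloor>real I * \<beta>\<rfloor>)" using less.IH b by blast
    also have "\<dots> = discrepancy (1 / \<beta>) c (nat \<lfloor>real I * \<beta>\<rfloor>)"
      using discrepancy_add_int[of \<gamma> "int (k * a')" c] b by (simp add: add.commute)
    also have "\<dots> = discrepancy x c (nat \<lfloor>real I * y\<rfloor>)"
      using discrepancy_renormalize[OF k c b(1,2) \<beta>irr, of a I] y by (simp add: y_def)
    finally show ?thesis .
  qed
  show ?case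
  proof (cases "N = 0")
    case N: False
    define m where "m = nat \<lfloor>real N * x\<rfloor>"
    have m: "real m \<le> real N * x" "real N * x < real m + 1"
      using a by (auto simp: m_def)
    have frN: "frac (real N * x) = real N * x - real m"
      using m by (subst frac_unique_iff) auto
    show ?thesis
    proof (cases "frac (real N * x) < c")
      case True
      define M where "M = nat \<lfloor>real m * y\<rfloor>"
      have "real m * y \<le> real N" using m xy by simp
      then have MN: "M \<le> N" unfolding M_def by linarith
      have "real m * \<beta> < real m * y \<or> m = 0"
        using ka mult_strict_left_mono[of \<beta> y "real m"] by (auto simp: y_def)
      then have "real m * \<beta> < real N" using \<open>real m * y \<le> real N\<close> N by force
      then have "0 \<le> discrepancy x c M" using key by (simp add: M_def)
      moreover have "(\<Sum>j=1..N. indicat_real {0..<c} (frac (real j * x)))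
        = (\<Sum>j=1..M. indicat_real {0..<c} (frac (real j * x))) + (real N - real M)"
      proof -
        have "indicat_real {0..<c} (frac (real j * x)) = 1" if j: "j \<in> {M<..N}" for j
        proof -
          have "real m * y < real j"
            using j y le_nat_floor_iff[of "real m * y" j] by (auto simp: M_def)
          then have 1: "real m \<le> real j * x" using xy(2) by simp
          have 2: "real j * x \<le> real N * x" using j a by (intro mult_right_mono) auto
          have "frac (real j * x) = real j * x - real m"
            using 1 2 m by (subst frac_unique_iff) auto
          then show ?thesis using 1 2 True frN by (simp add: indicator_def)
        qed
        then have "(\<Sum>j\<in>{M<..N}. indicat_real {0..<c} (frac (real j * x))) = (\<Sum>j\<in>{M<..N}. 1)"
          by (intro sum.cong) auto
        moreover have "{1..N} = {1..M} \<union> {M<..N}" using MN by auto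
        ultimately show ?thesis using MN by (simp add: sum.union_disjoint ivl_disj_int)
      qed
      moreover have "c * (real N - real M) \<le> 1 * (real N - real M)"
        using c MN by (intro mult_right_mono) auto
      ultimately show ?thesis by (simp add: discrepancy_def algebra_simps)
    next
      case False
      define M where "M = nat \<lfloor>real (Suc m) * y\<rfloor>"
      have "real N \<le> real (Suc m) * y" using m xy by simp
      then have NM: "N \<le> M" unfolding M_def by (simp add: le_nat_floor)
      \<comment> \<open>For m > 0, y = k a + \<beta> > 2 \<beta> gives (m + 1) \<beta> \<le> 2 m
        \<beta> < m y \<le> N; for m = 0 it is \<beta> < 1 \<le> N.\<close>
      have "real (Suc m) * \<beta> < real N"
      proof (cases "m = 0")
        case True
        then have "real (Suc m) * \<beta> = \<beta>" by simp
        moreover have "1 \<le> real N" using N by simp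
        ultimately show ?thesis using b(2) by linarith
      next
        case m0: False
        have "real (Suc m) * \<beta> \<le> (2 * real m) * \<beta>" using m0 b by (intro mult_right_mono) auto
        also have "\<dots> = real m * (2 * \<beta>)" by simp
        also have "2 * \<beta> < y" using b(2) ka unfolding y_def by linarith
        then have "real m * (2 * \<beta>) < real m * y" using m0 by (intro mult_strict_left_mono) auto
        also have "\<dots> \<le> real N" using m xy by simp
        finally show ?thesis .
      qed
      then have "0 \<le> discrepancy x c M" using key[of "Suc m"] by (simp add: M_def)
      moreover have "(\<Sum>j=1..M. indicat_real {0..<c} (frac (real j * x)))
        = (\<Sum>j=1..N. indicat_real {0..<c} (frac (real j * x)))"
      proof -
        have "indicat_real {0..<c} (frac (real j * x)) = 0" if j: "j \<in> {N<..M}" for j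
        proof -
          have "real j \<le> real (Suc m) * y"
            using j y le_nat_floor_iff[of "real (Suc m) * y" j] by (auto simp: M_def)
          then have "real j * x \<le> real (Suc m)" using xy by simp
          moreover have "real j * x \<noteq> real (Suc m)"
            using of_nat_mult_irrational[OF xirr, of j] j Rats_of_nat by (metis gr_implies_not0 greaterThanAtMost_iff not_gr_zero)
          ultimately have 1: "real j * x < real m + 1" by simp
          have 2: "real N * x \<le> real j * x" using j a by (intro mult_right_mono) auto
          have "frac (real j * x) = real j * x - real m"
            using 1 2 m by (subst frac_unique_iff) auto
          then show ?thesis using 1 2 False frN by (simp add: indicator_def)
        qed
        moreover have "{1..M} = {1..N} \<union> {N<..M}" using NM by auto
        ultimately show ?thesis by (simp add: sum.union_disjoint ivl_disj_int)
      qed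
      moreover have "c * real N \<le> c * real M" using c NM by (intro mult_left_mono) auto
      ultimately show ?thesis by (simp add: discrepancy_def)
    qed
  qed simp
qed

subsection \<open>Density\<close>

text \<open>A shift by \<open>m\<close> consists of \<open>m\<close> unit shifts, each of which
  telescopes to a difference of two values in [0, 1]; the bound is thus independent of the number of
  terms.\<close>

lemma sum_shift_diff_le:
  fixes F :: "int \<Rightarrow> real"
  assumes "\<And>i. 0 \<le> F i" "\<And>i. F i \<le> 1" "x0 \<le> X"
  shows "(\<Sum>x\<in>{x0<..X}. F (int x) - F (int x - int m)) \<le> real m"
proof (induction m)
  case (Suc m)
  have tel: "(\<Sum>x\<in>{x0<..X}. F (int x - int m) - F (int x - int m - 1))
      = F (int X - int m) - F (int x0 - int m)"
    using assms(3)
  proof (induction X rule: dec_induct)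
    case (step X)
    then have "{x0<..Suc X} = insert (Suc X) {x0<..X}" by auto
    then show ?case using step by (simp add: add.commute)
  qed simp
  have "(\<Sum>x\<in>{x0<..X}. F (int x) - F (int x - int (Suc m)))
      = (\<Sum>x\<in>{x0<..X}. F (int x) - F (int x - int m))
      + (\<Sum>x\<in>{x0<..X}. F (int x - int m) - F (int x - int m - 1))"
    by (simp add: sum.distrib[symmetric] algebra_simps)
  also have "\<dots> \<le> real m + (F (int X - int m) - F (int x0 - int m))"
    using Suc tel by simp
  also have "\<dots> \<le> real (Suc m)" using assms(1)[of "int x0 - int m"] assms(2)[of "int X - int m"] by simp
  finally show ?case .
qed simp

lemma moebius_irrational:
  fixes \<gamma> :: real and p q r s :: int
  assumes "\<gamma> \<notin> \<rat>" "p * s - q * r = 1" "0 < of_int q * \<gamma> + of_int s"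
  shows "(of_int p * \<gamma> + of_int r) / (of_int q * \<gamma> + of_int s) \<notin> \<rat>"
proof
  define x where "x = (of_int p * \<gamma> + of_int r) / (of_int q * \<gamma> + of_int s)"
  assume "(of_int p * \<gamma> + of_int r) / (of_int q * \<gamma> + of_int s) \<in> \<rat>"
  then have x: "x \<in> \<rat>" by (simp add: x_def)
  have xw: "x * (of_int q * \<gamma> + of_int s) = of_int p * \<gamma> + of_int r"
    using assms(3) by (simp add: x_def)
  then have e: "\<gamma> * (of_int p - x * of_int q) = x * of_int s - of_int r"
    by (simp add: algebra_simps)
  show False
  proof (cases "of_int p - x * of_int q = 0")
    case True
    have "1 = real_of_int (p * s - q * r)" using assms(2) by simp
    also have "\<dots> = (of_int p - x * of_int q) * of_int s + of_int q * (x * of_int s - of_int r)"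
      by (simp add: algebra_simps)
    also have "\<dots> = 0" using True e by simp
    finally show False by simp
  next
    case False
    then have "\<gamma> = (x * of_int s - of_int r) / (of_int p - x * of_int q)"
      using e by (simp add: field_simps)
    then have "\<gamma> \<in> \<rat>" using x by (auto intro!: Rats_divide Rats_diff Rats_mult)
    with assms show False by simp
  qed
qed

text \<open>The indicator equals floor(y) - floor(y - c); the second floor is written with its
  fractional part, whose differences telescope later.\<close>

lemma floor_eq_indicator:
  fixes y c :: real
  assumes c: "0 < c" "c < 1"
  shows "of_int \<lfloor>y\<rfloor> = indicat_real {0..<c} (frac y) + y - c - frac (y - c)"
proof (cases "frac y < c")
  case True
  have "y - c - (frac y - c + 1) = of_int (\<lfloor>y\<rfloor> - 1)" by (simp add: frac_def)
  then have "y - c - (frac y - c + 1) \<in> \<int>" by (metis Ints_of_int)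
  then have "frac (y - c) = frac y - c + 1"
    using True c frac_ge_0[of y] by (subst frac_unique_iff) linarith
  then show ?thesis using True frac_ge_0[of y] by (simp add: indicator_def) (simp add: frac_def)
next
  case False
  have "y - c - (frac y - c) = of_int \<lfloor>y\<rfloor>" by (simp add: frac_def)
  then have "y - c - (frac y - c) \<in> \<int>" by (metis Ints_of_int)
  then have "frac (y - c) = frac y - c"
    using False c frac_lt_1[of y] by (subst frac_unique_iff) linarith
  then show ?thesis using False by (simp add: indicator_def) (simp add: frac_def)
qed

text \<open>In the lattice coordinates \<open>(j, i) = X (s, r) + y (q, p)\<close> the strip \<open>0 \<le> j x - i < c\<close>
  becomes \<open>0 \<le> X \<gamma> - y < c (q \<gamma> + s)\<close>. As \<open>k\<close> divides \<open>q\<close> and \<open>s - 1\<close>, its width is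
  \<open>c\<close> modulo \<open>\<int> + \<int> \<gamma>\<close>, so up to telescoping sums the points are counted by the
  discrepancy of \<open>\<gamma>\<close>.\<close>

lemma discrepancy_moebius_bdd_below:
  fixes \<gamma> c :: real and p r :: int and h k q0 s0 :: nat
  assumes k: "0 < k" and c: "c = real h / real k" "0 < c" "c < 1"
    and \<gamma>: "1 < \<gamma>" "\<gamma> \<notin> \<rat>" and nonneg: "\<And>X. 0 \<le> discrepancy \<gamma> c X"
    and det: "p * int (1 + k * s0) - int (k * q0) * r = 1"
    and x: "x = (of_int p * \<gamma> + of_int r) / (real (k * q0) * \<gamma> + real (1 + k * s0))"
  shows "bdd_below (range (discrepancy x c))"
proof -
  define q s where "q = k * q0" and "s = 1 + k * s0"
  define m t where "m = h * q0" and "t = h * s0"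
  define w where "w = real q * \<gamma> + real s"
  \<comment> \<open>For X > x0 the strip has only positive ordinates, since X - m \<ge> t + 1 makes
    (X - m) \<gamma> - t - c positive. So X s + y q is a genuine index.\<close>
  define x0 where "x0 = m + t + 1"
  have "0 \<le> real q * \<gamma>" using \<gamma> by simp
  moreover have "1 \<le> real s" by (simp add: s_def)
  ultimately have w: "0 < w" "1 \<le> w" unfolding w_def by linarith+
  have hc: "real h = c * real k" using k c by simp
  have cw: "c * w = real m * \<gamma> + real t + c"
    by (simp add: w_def q_def s_def m_def t_def hc algebra_simps)
  \<comment> \<open>The losses: the columns up to \<open>x0\<close> (once for their area, once for
    their count), the boundary terms \<open>m\<close> of the telescoping sum, and the incomplete
    last column.\<close>
  define C where "C = real x0 * (c * w) + real x0 + real m + c * w"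
  have "- C \<le> discrepancy x c N" for N
  proof -
    define X where "X = nat \<lfloor>real N / w\<rfloor>"
    have X: "real X * w \<le> real N" "real N < (real X + 1) * w"
    proof -
      have "real X \<le> real N / w" "real N / w < real X + 1"
        using w by (auto simp: X_def)
      then show "real X * w \<le> real N" "real N < (real X + 1) * w"
        using w by (simp_all add: pos_le_divide_eq pos_divide_less_eq)
    qed
    have cN: "c * real N \<le> real X * (c * w) + c * w"
      using mult_left_mono[OF less_imp_le[OF X(2)], of c] c by (simp add: algebra_simps)
    show ?thesis
    proof (cases "x0 \<le> X")
      case False
      have "real X * (c * w) \<le> real x0 * (c * w)" using False c w by (intro mult_right_mono) auto
      then have "c * real N \<le> C" using cN by (simp add: C_def)
      then show ?thesis using discrepancy_eq_card[of c x N] c by simp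
    next
      case True
      define Y where "Y = (\<lambda>X'::nat. {\<lfloor>(real X' - real m) * \<gamma> - real t - c\<rfloor> <.. \<lfloor>real X' * \<gamma>\<rfloor>})"
      define P where "P = Sigma {x0<..X} Y"
      define S where "S = {j \<in> {1..N}. frac (real j * x) < c}"
      define f where "f = (\<lambda>(X'::nat, y::int). nat (int X' * int s + y * int q))"
      have Y: "(real X' - real m) * \<gamma> - real t - c < real_of_int y" "real_of_int y \<le> real X' * \<gamma>"
        if "y \<in> Y X'" for X' y
        using that by (auto simp: Y_def) linarith+
      have pos: "0 < y" "X' \<le> X" "x0 < X'" if "(X', y) \<in> P" for X' y
      proof -
        show X': "X' \<le> X" "x0 < X'" using that by (auto simp: P_def)
        have "real t + 1 \<le> real X' - real m" using X'(2) by (simp add: x0_def)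
        moreover from this have "(real X' - real m) * 1 \<le> (real X' - real m) * \<gamma>"
          using \<gamma> by (intro mult_left_mono) auto
        ultimately have "real t + 1 \<le> (real X' - real m) * \<gamma>"
          unfolding mult_1_right by (rule order_trans)
        moreover have "(real X' - real m) * \<gamma> - real t - c < real_of_int y"
          using that by (intro Y(1)) (simp add: P_def)
        ultimately have "real t + 1 - real t - c < real_of_int y" by simp
        then have "0 < real_of_int y" using c(3) by simp
        then show "0 < y" by simp
      qed
      have fX: "int (f (X', y)) = int X' * int s + y * int q" if "(X', y) \<in> P" for X' y
        using pos[OF that] by (simp add: f_def)
      have fr: "frac (real (f (X', y)) * x) = (real X' * \<gamma> - of_int y) / w"
        and frc: "(real X' * \<gamma> - of_int y) / w < c" if XP: "(X', y) \<in> P" for X' y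
      proof -
        have yY: "y \<in> Y X'" using XP by (simp add: P_def)
        have "real X' * \<gamma> - of_int y < c * w"
          unfolding cw using Y(1)[OF yY] by (simp add: algebra_simps)
        then show lt: "(real X' * \<gamma> - of_int y) / w < c" using w by (simp add: pos_divide_less_eq)
        have rf: "real (f (X', y)) = real X' * real s + of_int y * real q"
          using fX[OF XP] by (metis of_int_add of_int_mult of_int_of_nat_eq)
        have dt: "of_int p * real s - real q * of_int r = 1"
          using det unfolding s_def[symmetric] q_def[symmetric]
          by (metis of_int_1 of_int_diff of_int_mult of_int_of_nat_eq)
        have xw: "x * w = of_int p * \<gamma> + of_int r" using w x by (simp add: w_def q_def s_def)
        have "real (f (X', y)) * x * w = (real X' * \<gamma> - of_int y) + of_int (int X' * r + y * p) * w"
        proof -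
          have "real (f (X', y)) * x * w = (real X' * real s + of_int y * real q) * (of_int p * \<gamma> + of_int r)"
            using rf xw by simp
          also have "\<dots> = (of_int p * real s - real q * of_int r) * (real X' * \<gamma> - of_int y)
            + of_int (int X' * r + y * p) * w"
            by (simp add: w_def algebra_simps)
          finally show ?thesis using dt by simp
        qed
        then have "real (f (X', y)) * x = (real X' * \<gamma> - of_int y) / w + of_int (int X' * r + y * p)"
          using w by (simp add: field_simps)
        then have "frac (real (f (X', y)) * x) = frac ((real X' * \<gamma> - of_int y) / w)"
          by (simp only: frac_add_int)
        also have "\<dots> = (real X' * \<gamma> - of_int y) / w"
          using less_trans[OF lt c(3)] w(1) Y(2)[OF yY] by (subst frac_eq) simp
        finally show "frac (real (f (X', y)) * x) = (real X' * \<gamma> - of_int y) / w" .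
      qed
      \<comment> \<open>Only a lower bound for the count is wanted, so it is enough to embed the
        lattice points of \<open>P\<close> into the counted indices.\<close>
      have "f ` P \<subseteq> S"
      proof clarify
        fix X' y assume XP: "(X', y) \<in> P"
        have y: "real_of_int y \<le> real X' * \<gamma>" using Y(2) XP by (simp add: P_def)
        have "real_of_int (int (f (X', y))) = real X' * real s + of_int y * real q"
          using fX[OF XP] by (metis of_int_add of_int_mult of_int_of_nat_eq)
        also have "\<dots> \<le> real X' * real s + real X' * \<gamma> * real q" using y by (simp add: mult_right_mono)
        also have "\<dots> = real X' * w" by (simp add: w_def algebra_simps)
        also have "\<dots> \<le> real X * w" using pos[OF XP] w by simp
        also have "\<dots> \<le> real N" by (rule X)
        finally have "f (X', y) \<le> N" by simp
        moreover have "1 \<le> f (X', y)"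
        proof -
          have "0 < int (f (X', y))"
            unfolding fX[OF XP] using pos[OF XP]
            by (intro add_pos_nonneg mult_pos_pos mult_nonneg_nonneg) (auto simp: s_def simp del: of_nat_add of_nat_mult)
          then show ?thesis by simp
        qed
        ultimately show "f (X', y) \<in> S" using fr[OF XP] frc[OF XP] by (simp add: S_def)
      qed
      moreover have "inj_on f P"
      proof (rule inj_onI, clarify)
        fix X1 y1 X2 y2 assume P: "(X1, y1) \<in> P" "(X2, y2) \<in> P" "f (X1, y1) = f (X2, y2)"
        have "(real X1 * \<gamma> - of_int y1) / w = (real X2 * \<gamma> - of_int y2) / w"
          unfolding fr[OF P(1), symmetric] fr[OF P(2), symmetric] P(3) ..
        then have "real X1 * \<gamma> - of_int y1 = real X2 * \<gamma> - of_int y2" using w by simp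
        then have e: "(real X1 - real X2) * \<gamma> = of_int (y1 - y2)" by (simp add: algebra_simps)
        have "X1 = X2"
        proof (rule ccontr)
          assume "X1 \<noteq> X2"
          then have "\<gamma> = of_int (y1 - y2) / (real X1 - real X2)" using e by (simp add: field_simps)
          then have "\<gamma> \<in> \<rat>" by (metis Rats_diff Rats_divide Rats_of_int Rats_of_nat)
          with \<gamma> show False by simp
        qed
        then show "X1 = X2 \<and> y1 = y2" using e by simp
      qed
      moreover have "finite S" by (simp add: S_def)
      ultimately have cardle: "card P \<le> card S" by (metis card_inj_on_le)
      \<comment> \<open>\<open>F\<close> records the fractional parts at the two ends of a column;
        up to integers and the constant \<open>c\<close> these ends differ by a shift of the column
        index by \<open>m\<close>, so their contributions telescope.\<close>
      define F where "F = (\<lambda>i::int. frac (of_int i * \<gamma> - c))"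
      have cardY: "real (card (Y X')) = indicat_real {0..<c} (frac (real X' * \<gamma>)) + (real t + real m * \<gamma>)
          - (F (int X') - F (int X' - int m))" if X': "X' \<in> {x0<..X}" for X'
      proof -
        have "0 \<le> real m * \<gamma> + real t + c" using \<gamma> c by simp
        then have "(real X' - real m) * \<gamma> - real t - c \<le> real X' * \<gamma>" by (simp add: algebra_simps)
        then have "\<lfloor>(real X' - real m) * \<gamma> - real t - c\<rfloor> \<le> \<lfloor>real X' * \<gamma>\<rfloor>" by (rule floor_mono)
        then have "real (card (Y X')) = of_int (\<lfloor>real X' * \<gamma>\<rfloor> - \<lfloor>(real X' - real m) * \<gamma> - real t - c\<rfloor>)"
          by (simp add: Y_def)
        also have "\<lfloor>(real X' - real m) * \<gamma> - real t - c\<rfloor> = \<lfloor>(real X' - real m) * \<gamma> - c\<rfloor> - int t"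
          using floor_diff_of_int[of "(real X' - real m) * \<gamma> - c" "int t"] by (simp add: algebra_simps)
        finally have 1: "real (card (Y X')) = of_int \<lfloor>real X' * \<gamma>\<rfloor> - of_int \<lfloor>(real X' - real m) * \<gamma> - c\<rfloor> + real t"
          by simp
        have 2: "of_int \<lfloor>(real X' - real m) * \<gamma> - c\<rfloor> = (real X' - real m) * \<gamma> - c - F (int X' - int m)"
          by (simp add: F_def frac_def)
        have 3: "of_int \<lfloor>real X' * \<gamma>\<rfloor> = indicat_real {0..<c} (frac (real X' * \<gamma>)) + real X' * \<gamma> - c - F (int X')"
          using floor_eq_indicator[OF c(2,3), of "real X' * \<gamma>"] by (simp add: F_def)
        show ?thesis unfolding 1 2 3 by (simp add: algebra_simps)
      qed
      have cardXx: "real (card {x0<..X}) = real X - real x0" using True by simp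
      have "real (card P) = (\<Sum>X'\<in>{x0<..X}. real (card (Y X')))"
        unfolding P_def by (subst card_SigmaI) (auto simp: Y_def)
      also have "\<dots> = (\<Sum>X'\<in>{x0<..X}. indicat_real {0..<c} (frac (real X' * \<gamma>))
          + (real t + real m * \<gamma>) - (F (int X') - F (int X' - int m)))"
        by (intro sum.cong refl cardY)
      also have "\<dots> = (\<Sum>X'\<in>{x0<..X}. indicat_real {0..<c} (frac (real X' * \<gamma>)))
          + (real X - real x0) * (real t + real m * \<gamma>)
          - (\<Sum>X'\<in>{x0<..X}. F (int X') - F (int X' - int m))"
        by (simp only: sum_subtractf sum.distrib sum_constant cardXx distrib_left)
      finally have cardP: "real (card P) = (\<Sum>X'\<in>{x0<..X}. indicat_real {0..<c} (frac (real X' * \<gamma>)))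
          + (real X - real x0) * (real t + real m * \<gamma>)
          - (\<Sum>X'\<in>{x0<..X}. F (int X') - F (int X' - int m))" .
      have "(\<Sum>X'\<in>{x0<..X}. F (int X') - F (int X' - int m)) \<le> real m"
        using True by (intro sum_shift_diff_le) (auto simp: F_def frac_ge_0 frac_lt_1 less_imp_le)
      then have 1: "real (card P) \<ge> (\<Sum>X'\<in>{x0<..X}. indicat_real {0..<c} (frac (real X' * \<gamma>)))
          + (real X - real x0) * (real t + real m * \<gamma>) - real m" unfolding cardP by simp
      have "(\<Sum>X'=1..X. indicat_real {0..<c} (frac (real X' * \<gamma>)))
          = (\<Sum>X'=1..x0. indicat_real {0..<c} (frac (real X' * \<gamma>)))
          + (\<Sum>X'\<in>{x0<..X}. indicat_real {0..<c} (frac (real X' * \<gamma>)))"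
      proof -
        have "{1..X} = {1..x0} \<union> {x0<..X}" using True by auto
        then show ?thesis by (simp add: sum.union_disjoint ivl_disj_int)
      qed
      also have "(\<Sum>X'=1..x0. indicat_real {0..<c} (frac (real X' * \<gamma>))) \<le> (\<Sum>X'=1..x0. 1)"
        by (intro sum_mono) (auto simp: indicator_def)
      also have "\<dots> = real x0" by simp
      finally have "(\<Sum>X'\<in>{x0<..X}. indicat_real {0..<c} (frac (real X' * \<gamma>))) \<ge> c * real X - real x0"
        using nonneg[of X] by (simp add: discrepancy_def)
      with 1 have "real (card S) \<ge> c * real X - real x0
          + (real X - real x0) * (real t + real m * \<gamma>) - real m" using cardle by simp
      moreover have "real X * (c * w) - real x0 * (c * w) = (real X - real x0) * (real t + real m * \<gamma>)
          + c * real X - c * real x0"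
        unfolding cw by (simp add: algebra_simps)
      moreover have "0 \<le> c * real x0" using c by simp
      ultimately have "real (card S) - c * real N \<ge> - C" using cN by (simp add: C_def)
      then show ?thesis using discrepancy_eq_card[of c x N] c by (simp add: S_def)
    qed
  qed
  then show ?thesis by (auto simp: bdd_below_def intro!: exI[of _ "- C"])
qed

text \<open>A fraction p/q near \<open>z\<close>, with \<open>q\<close> a power of \<open>k\<close>
  and \<open>p\<close> congruent to 1 modulo \<open>k\<close>, is completed to a matrix of
  determinant 1. Then \<open>s\<close> is congruent to 1 too, and the image of \<gamma> is at
  distance 1/(q w) from p/q, which gives a total error of at most (k + 1)/q.\<close>

lemma bdd_below_dense:
  fixes \<gamma> c z e :: real
  assumes k: "2 \<le> k" and c: "c = real h / real k" "0 < c" "c < 1"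
    and \<gamma>: "1 < \<gamma>" "\<gamma> \<notin> \<rat>" and nonneg: "\<And>X. 0 \<le> discrepancy \<gamma> c X" and e: "0 < e"
  obtains x where "\<bar>x - z\<bar> < e" "x \<notin> \<rat>" "bdd_below (range (discrepancy x c))"
proof -
  obtain n where n: "(1 / real k) ^ n < e / (real k + 1)"
    using real_arch_pow_inv[of "e / (real k + 1)" "1 / real k"] e k by auto
  define q where "q = k ^ Suc n"
  have q: "0 < q" "1 \<le> q" using k by (auto simp: q_def)
  have qe: "(real k + 1) / real q < e"
  proof -
    have "real k ^ n \<le> real q" using k by (simp add: q_def)
    then have "1 / real q \<le> (1 / real k) ^ n"
      using k by (simp add: power_one_over frac_le)
    then have "1 / real q < e / (real k + 1)" using n by simp
    then show ?thesis using q by (simp add: field_simps)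
  qed
  \<comment> \<open>Rounding \<open>z q\<close> to the class of 1 modulo \<open>k\<close> costs at
    most \<open>k\<close> and makes \<open>p\<close> coprime to the power \<open>q\<close> of
    \<open>k\<close>.\<close>
  define p where "p = 1 + int k * \<lfloor>z * real q / real k\<rfloor>"
  have "coprime p (int k)" unfolding p_def
    by (metis coprime_1_left coprime_iff_gcd_eq_1 gcd_add_mult mult.commute gcd.commute add.commute)
  then have "coprime p (int q)" by (simp add: q_def)
  then obtain u v where uv: "u * p + v * int q = 1"
    using bezout_int[of p "int q"] by auto
  define s where "s = u mod int q"
  have k_dvd_q: "int k dvd int q" by (simp add: q_def)
  define r where "r = (p * s - 1) div int q"
  have "int q dvd p * s - 1"
  proof -
    have "p * s - 1 = p * (u - int q * (u div int q)) - (u * p + v * int q)"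
      unfolding uv s_def by (simp add: minus_mult_div_eq_mod)
    also have "\<dots> = int q * (- p * (u div int q) - v)" by (simp add: algebra_simps)
    finally show ?thesis by simp
  qed
  then have det: "p * s - int q * r = 1" by (simp add: r_def)
  have s0: "0 \<le> s" using q by (simp add: s_def)
  have "int k dvd s - 1"
  proof -
    have "int k dvd p * s - 1" using det k_dvd_q by (metis add_diff_cancel_right' diff_add_cancel dvd_mult2 add.commute)
    moreover have "p * s - 1 = (s - 1) + int k * (\<lfloor>z * real q / real k\<rfloor> * s)"
      by (simp add: p_def algebra_simps)
    ultimately show ?thesis by (metis dvd_add_left_iff dvd_triv_left)
  qed
  then obtain l where l: "s - 1 = int k * l" by blast
  have "0 \<le> l"
  proof (rule ccontr)
    assume "\<not> 0 \<le> l"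
    then have "int k * l \<le> int k * (- 1)" by (intro mult_left_mono) auto
    then show False using l s0 k by simp
  qed
  then obtain L where "l = int L" by (metis nonneg_int_cases)
  then have s: "s = int (1 + k * L)" using l by simp
  have qk: "q = k * k ^ n" by (simp add: q_def)
  define w where "w = real q * \<gamma> + real (1 + k * L)"
  define x where "x = (of_int p * \<gamma> + of_int r) / w"
  have "real q * 1 \<le> real q * \<gamma>" using \<gamma> q by (intro mult_left_mono) auto
  then have w: "1 \<le> w" using q by (simp add: w_def)
  have bdd: "bdd_below (range (discrepancy x c))"
    using discrepancy_moebius_bdd_below[OF _ c \<gamma> nonneg, of p "L" "k ^ n" r x] det k
    unfolding s qk[symmetric] by (simp add: x_def w_def)
  have irr: "x \<notin> \<rat>"
    using moebius_irrational[OF \<gamma>(2), of p s "int q" r] det w unfolding s by (simp add: x_def w_def)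
  have "of_int p / real q - x = 1 / (real q * w)"
  proof -
    have "of_int p * w - real q * (of_int p * \<gamma> + of_int r) = of_int (p * s - int q * r)"
      unfolding s by (simp add: w_def algebra_simps)
    then show ?thesis using w q unfolding det by (simp add: x_def field_simps)
  qed
  moreover have "1 / (real q * w) \<le> 1 / real q"
    using w q by (intro divide_left_mono) auto
  moreover have "0 \<le> 1 / (real q * w)" using w by simp
  moreover have "of_int p / real q - z \<le> 1 / real q" "- (real k / real q) \<le> of_int p / real q - z"
  proof -
    have "real k * of_int \<lfloor>z * real q / real k\<rfloor> \<le> real k * (z * real q / real k)"
      by (intro mult_left_mono) auto
    then have "of_int p \<le> 1 + z * real q" using k by (simp add: p_def)
    then have "of_int p / real q \<le> (1 + z * real q) / real q" by (rule divide_right_mono) simp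
    then show "of_int p / real q - z \<le> 1 / real q" using q by (simp add: add_divide_distrib)
    have "real k * (z * real q / real k - 1) \<le> real k * of_int \<lfloor>z * real q / real k\<rfloor>"
      by (intro mult_left_mono) linarith+
    then have "z * real q - real k \<le> of_int p" using k by (simp add: p_def algebra_simps)
    then have "(z * real q - real k) / real q \<le> of_int p / real q" by (rule divide_right_mono) simp
    then show "- (real k / real q) \<le> of_int p / real q - z" using q by (simp add: diff_divide_distrib)
  qed
  moreover have "(real k + 1) / real q = real k / real q + 1 / real q" by (simp add: add_divide_distrib)
  moreover have "0 \<le> real k / real q" "0 \<le> 1 / real q" by auto
  ultimately have "\<bar>x - z\<bar> < e" using qe by linarith
  then show ?thesis using that irr bdd by blast
qed

subsection \<open>A Cantor set with positive dimension\<close>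

definition cantor_digit :: "nat \<Rightarrow> real \<Rightarrow> nat" where
  "cantor_digit k y = (if y < 1/2 then k else 2 * k)"

text \<open>The binary expansion of \<open>y\<close> is read as a continued fraction with partial quotients
  \<open>k\<close> and \<open>2 k\<close>.\<close>

fun cantor_approx :: "nat \<Rightarrow> nat \<Rightarrow> real \<Rightarrow> real" where
  "cantor_approx k 0 y = 0"
| "cantor_approx k (Suc n) y = 1 / (real (cantor_digit k y) + cantor_approx k n (frac (2 * y)))"

definition cantor_cf :: "nat \<Rightarrow> real \<Rightarrow> real" where
  "cantor_cf k y = lim (\<lambda>n. cantor_approx k n y)"

lemma cantor_digit_bounds:
  assumes "2 \<le> k"
  shows "2 \<le> real (cantor_digit k y)" "real (cantor_digit k y) \<le> 2 * real k"
  using assms by (auto simp: cantor_digit_def)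

lemma inverse_shift_diff:
  fixes d u v :: real
  assumes "0 < d + u" "0 < d + v"
  shows "1 / (d + u) - 1 / (d + v) = (v - u) / ((d + u) * (d + v))"
  using assms by (simp add: field_simps)

lemma cantor_approx_bounds:
  assumes "2 \<le> k"
  shows "0 \<le> cantor_approx k n y \<and> cantor_approx k n y \<le> 1"
proof (induction n arbitrary: y)
  case (Suc n)
  have "1 \<le> real (cantor_digit k y) + cantor_approx k n (frac (2 * y))"
    using cantor_digit_bounds(1)[OF assms, of y] Suc[of "frac (2 * y)"] by linarith
  then show ?case by simp
qed simp

text \<open>For d \<ge> 2 and u, v \<ge> 0 the map u -> 1/(d + u) shrinks distances by (d + u) (d +
  v), for which 2 is a crude lower bound.\<close>

lemma cantor_approx_Cauchy:
  assumes k: "2 \<le> k"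
  shows "\<bar>cantor_approx k (n + m) y - cantor_approx k n y\<bar> \<le> (1/2) ^ n"
proof (induction n arbitrary: y)
  case 0
  then show ?case using cantor_approx_bounds[OF k, of m y] by simp
next
  case (Suc n)
  define d u v where "d = real (cantor_digit k y)" and "u = cantor_approx k (n + m) (frac (2 * y))"
    and "v = cantor_approx k n (frac (2 * y))"
  have d: "2 \<le> d" using cantor_digit_bounds[OF k] by (simp add: d_def)
  have u: "0 \<le> u" "0 \<le> v" using cantor_approx_bounds[OF k] by (auto simp: u_def v_def)
  have 2: "2 \<le> (d + u) * (d + v)"
    using mult_mono[of 2 "d + u" 1 "d + v"] d u by simp
  have "\<bar>cantor_approx k (Suc n + m) y - cantor_approx k (Suc n) y\<bar> = \<bar>(v - u) / ((d + u) * (d + v))\<bar>"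
    using inverse_shift_diff[of d u v] d u by (simp add: d_def u_def v_def)
  also have "\<dots> = \<bar>u - v\<bar> / ((d + u) * (d + v))" using d u by (simp add: abs_mult)
  also have "\<dots> \<le> \<bar>u - v\<bar> / 2" using 2 by (intro divide_left_mono) auto
  also have "\<dots> \<le> (1/2) ^ Suc n" using Suc[of "frac (2 * y)"] by (simp add: u_def v_def)
  finally show ?case .
qed

lemma cantor_approx_LIMSEQ:
  assumes k: "2 \<le> k"
  shows "(\<lambda>n. cantor_approx k n y) \<longlonglongrightarrow> cantor_cf k y"
proof -
  have "Cauchy (\<lambda>n. cantor_approx k n y)"
  proof (rule CauchyI')
    fix e :: real assume "0 < e"
    then obtain n where n: "(1/2) ^ n < e" using real_arch_pow_inv[of e "1/2"] by auto
    have "dist (cantor_approx k i y) (cantor_approx k j y) < e" if "n \<le> i" "i < j" for i j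
    proof -
      have "\<bar>cantor_approx k (i + (j - i)) y - cantor_approx k i y\<bar> \<le> (1/2) ^ i"
        by (rule cantor_approx_Cauchy[OF k])
      also have "\<dots> \<le> (1/2) ^ n" using that by (intro power_decreasing) auto
      finally show ?thesis using n that by (simp add: dist_real_def abs_minus_commute)
    qed
    then show "\<exists>M. \<forall>m\<ge>M. \<forall>n>m. dist (cantor_approx k m y) (cantor_approx k n y) < e"
      by blast
  qed
  then show ?thesis
    unfolding cantor_cf_def by (simp add: Cauchy_convergent_iff convergent_LIMSEQ_iff)
qed

lemma cantor_cf_nonneg: "2 \<le> k \<Longrightarrow> 0 \<le> cantor_cf k y"
  using cantor_approx_bounds by (intro LIMSEQ_le_const[OF cantor_approx_LIMSEQ]) auto

lemma cantor_cf_rec: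
  assumes k: "2 \<le> k"
  shows "cantor_cf k y = 1 / (real (cantor_digit k y) + cantor_cf k (frac (2 * y)))"
proof -
  have "(\<lambda>n. cantor_approx k (Suc n) y) \<longlonglongrightarrow> cantor_cf k y"
    using cantor_approx_LIMSEQ[OF k] by (rule LIMSEQ_Suc)
  moreover have "(\<lambda>n. cantor_approx k (Suc n) y) \<longlonglongrightarrow>
      1 / (real (cantor_digit k y) + cantor_cf k (frac (2 * y)))"
    using cantor_digit_bounds[OF k, of y] cantor_cf_nonneg[OF k, of "frac (2 * y)"]
    by (auto intro!: tendsto_intros cantor_approx_LIMSEQ[OF k])
  ultimately show ?thesis by (rule LIMSEQ_unique)
qed

lemma cantor_cf_bounds:
  assumes k: "2 \<le> k"
  shows "0 < cantor_cf k y" "cantor_cf k y < 1"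
proof -
  define D where "D = real (cantor_digit k y) + cantor_cf k (frac (2 * y))"
  have "2 \<le> D"
    unfolding D_def using cantor_digit_bounds(1)[OF k, of y] cantor_cf_nonneg[OF k, of "frac (2 * y)"]
    by linarith
  moreover have "cantor_cf k y = 1 / D" unfolding D_def by (rule cantor_cf_rec[OF k])
  ultimately show "0 < cantor_cf k y" "cantor_cf k y < 1" by simp_all
qed

lemma cf_heavy_range_cantor_cf:
  assumes k: "2 \<le> k"
  shows "cf_heavy k (range (cantor_cf k))"
proof -
  have "\<exists>a>0. cantor_digit k y = k * a" for y
    unfolding cantor_digit_def by (metis mult.commute mult_1 zero_less_numeral zero_less_one)
  then show ?thesis
    unfolding cf_heavy_def using cantor_cf_rec[OF k] cantor_cf_bounds[OF k]
    by (metis (mono_tags, lifting) imageE rangeI)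
qed

text \<open>If the first binary digits agree, passing to the tails doubles the distance of the
  arguments and costs at most the factor (2 k + 1)^2 in the values. If they differ, the partial
  quotients are \<open>k\<close> apart, so the denominators differ by at least k - 1 \<ge>
  1.\<close>

lemma cantor_cf_separated:
  assumes k: "2 \<le> k"
  shows "x \<in> {0..<1} \<Longrightarrow> y \<in> {0..<1} \<Longrightarrow> (1/2) ^ n \<le> \<bar>x - y\<bar> \<Longrightarrow>
    (1 / (2 * real k + 1)\<^sup>2) ^ n \<le> \<bar>cantor_cf k x - cantor_cf k y\<bar>"
proof (induction n arbitrary: x y)
  case 0
  then show ?case by auto
next
  case (Suc n)
  define K where "K = 2 * real k + 1"
  have K: "0 < K" "1 \<le> K\<^sup>2" using k by (auto simp: K_def)
  define x' y' where "x' = frac (2 * x)" and "y' = frac (2 * y)"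
  define d e u v where "d = real (cantor_digit k x)" and "e = real (cantor_digit k y)"
    and "u = cantor_cf k x'" and "v = cantor_cf k y'"
  have de: "2 \<le> d" "2 \<le> e" "d \<le> 2 * real k" "e \<le> 2 * real k"
    using cantor_digit_bounds[OF k] by (auto simp: d_def e_def)
  have uv: "0 < u" "u < 1" "0 < v" "v < 1" using cantor_cf_bounds[OF k] by (auto simp: u_def v_def)
  have rx: "cantor_cf k x = 1 / (d + u)" and ry: "cantor_cf k y = 1 / (e + v)"
    unfolding d_def e_def u_def v_def x'_def y'_def by (rule cantor_cf_rec[OF k])+
  have fac: "0 < d + u" "0 < e + v" "d + u \<le> K" "e + v \<le> K"
    using de uv unfolding K_def by linarith+
  have prod: "0 < (d + u) * (e + v)" using fac by simp
  have prodK: "(d + u) * (e + v) \<le> K\<^sup>2"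
    unfolding power2_eq_square using fac by (intro mult_mono) auto
  have diff: "\<bar>cantor_cf k x - cantor_cf k y\<bar> = \<bar>(e + v) - (d + u)\<bar> / ((d + u) * (e + v))"
    using inverse_shift_diff[of 0 "d + u" "e + v"] fac
    unfolding rx ry by (simp add: abs_mult)
  have ge: "\<bar>(e + v) - (d + u)\<bar> / K\<^sup>2 \<le> \<bar>cantor_cf k x - cantor_cf k y\<bar>"
    unfolding diff using prod prodK K(1) by (intro divide_left_mono) auto
  have "(1 / K\<^sup>2) ^ n \<le> \<bar>(e + v) - (d + u)\<bar>"
  proof (cases "x < 1/2 \<longleftrightarrow> y < 1/2")
    case True
    have xy': "2 * x - x' = 2 * y - y'"
    proof -
      have "x' = (if x < 1/2 then 2 * x else 2 * x - 1)"
        using Suc.prems unfolding x'_def by (subst frac_unique_iff) auto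
      moreover have "y' = (if y < 1/2 then 2 * y else 2 * y - 1)"
        using Suc.prems unfolding y'_def by (subst frac_unique_iff) auto
      ultimately show ?thesis using True by simp
    qed
    have "x' \<in> {0..<1}" "y' \<in> {0..<1}" by (auto simp: x'_def y'_def frac_lt_1)
    moreover have "(1/2) ^ n \<le> \<bar>x' - y'\<bar>" using Suc.prems(3) xy' by (simp add: abs_if split: if_splits)
    ultimately have "(1 / K\<^sup>2) ^ n \<le> \<bar>u - v\<bar>"
      using Suc.IH unfolding u_def v_def K_def by blast
    moreover have "d = e" using True by (simp add: d_def e_def cantor_digit_def)
    ultimately show ?thesis by simp
  next
    case False
    then have "\<bar>e - d\<bar> = real k" by (auto simp: d_def e_def cantor_digit_def)
    moreover have "\<bar>v - u\<bar> < 1" using uv by auto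
    ultimately have "1 \<le> \<bar>(e + v) - (d + u)\<bar>" using k by linarith
    moreover have "(1 / K\<^sup>2) ^ n \<le> 1" using K by (intro power_le_one) auto
    ultimately show ?thesis by simp
  qed
  then have "(1 / K\<^sup>2) ^ Suc n \<le> \<bar>(e + v) - (d + u)\<bar> / K\<^sup>2"
    using K by (simp add: divide_right_mono)
  then show ?case using ge unfolding K_def by linarith
qed

lemma cantor_cf_inverse_Hoelder:
  assumes k: "2 \<le> k"
  defines "s \<equiv> ln 2 / ln ((2 * real k + 1)\<^sup>2)"
  shows "0 < s" and "x \<in> {0..<1} \<Longrightarrow> y \<in> {0..<1} \<Longrightarrow>
    \<bar>x - y\<bar> \<le> 2 * \<bar>cantor_cf k x - cantor_cf k y\<bar> powr s"
proof -
  define K where "K = (2 * real k + 1)\<^sup>2"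
  have K: "1 < K" using k by (auto simp: K_def intro: one_less_power)
  show s: "0 < s" using K by (simp add: s_def K_def)
  have Ks: "K powr s = 2" using K by (simp add: powr_def s_def K_def[symmetric])
  assume xy: "x \<in> {0..<1}" "y \<in> {0..<1}"
  show "\<bar>x - y\<bar> \<le> 2 * \<bar>cantor_cf k x - cantor_cf k y\<bar> powr s"
  proof (cases "x = y")
    case False
    then obtain n where n: "(1/2) ^ n < \<bar>x - y\<bar>"
      using real_arch_pow_inv[of "\<bar>x - y\<bar>" "1/2"] by auto
    \<comment> \<open>The first dyadic scale not above |x - y|; the previous one exceeds it, hence
      the constant 2. The exponent \<open>s\<close> is made so that the separation at depth
      \<open>N\<close>, raised to \<open>s\<close>, is 2^-N.\<close>
    define N where "N = (LEAST n. (1/2::real) ^ n \<le> \<bar>x - y\<bar>)"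
    have N: "(1/2) ^ N \<le> \<bar>x - y\<bar>" unfolding N_def by (rule LeastI[of _ n]) (use n in simp)
    have "N \<noteq> 0"
    proof
      assume "N = 0"
      with N xy show False by auto
    qed
    then obtain M where M: "N = Suc M" by (metis not0_implies_Suc)
    then have "\<not> (1/2) ^ M \<le> \<bar>x - y\<bar>"
      using not_less_Least[of M "\<lambda>n. (1/2::real) ^ n \<le> \<bar>x - y\<bar>"] by (simp add: N_def)
    then have "\<bar>x - y\<bar> \<le> 2 * (1/2) ^ N" using M by simp
    also have "(1/2) ^ N = ((1 / K) ^ N) powr s"
    proof -
      have "((1 / K) ^ N) powr s = ((1 / K) powr s) ^ N"
        using K by (simp add: powr_realpow[symmetric] powr_powr mult.commute)
      also have "(1 / K) powr s = 1 / 2" using Ks K by (simp add: powr_divide)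
      finally show ?thesis by simp
    qed
    also have "\<dots> \<le> \<bar>cantor_cf k x - cantor_cf k y\<bar> powr s"
      using cantor_cf_separated[OF k xy N] s K by (intro powr_mono2) (auto simp: K_def)
    finally show ?thesis by simp
  qed simp
qed

subsection \<open>The set of one-side bounded discrepancies\<close>

text \<open>Reflection replaces \<open>c\<close> by (k - h)/k, again a reduced fraction with
  denominator \<open>k\<close>, so the same closed sets serve for both kinds of boundedness.\<close>

lemma one_side_bounded_set_subset:
  assumes k: "0 < k" and hk: "coprime h k" "0 < h" "h < k" and c: "c = real h / real k"
  shows "one_side_bounded_set c \<subseteq> (\<Union>Q. no_close_upper k Q \<union> uminus ` no_close_upper k Q) - \<rat>"
proof
  fix x assume x: "x \<in> one_side_bounded_set c"
  then have irr: "x \<notin> \<rat>" and osb: "one_side_bounded (discrepancy x c)"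
    by (auto simp: one_side_bounded_set_def)
  have cR: "c \<in> \<rat>" by (simp add: c)
  have "\<exists>Q. x \<in> no_close_upper k Q \<union> uminus ` no_close_upper k Q"
  proof (cases "bdd_below (range (discrepancy x c))")
    case True
    then show ?thesis using bdd_below_imp_no_close_upper[OF k hk(1,3) c irr] by blast
  next
    case False
    then have "bdd_above (range (discrepancy x c))" using osb by (simp add: one_side_bounded_def)
    then obtain B where B: "\<And>n. discrepancy x c n \<le> B" unfolding bdd_above_def by blast
    have "bdd_below (range (discrepancy (- x) (1 - c)))"
    proof (rule bdd_belowI)
      fix v assume "v \<in> range (discrepancy (- x) (1 - c))"
      then obtain n where "v = - discrepancy x c n" using discrepancy_uminus[OF irr cR] by blast
      then show "- B \<le> v" using B[of n] by simp
    qed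
    moreover have "coprime (k - h) k"
      using hk(1) gcd_diff2_nat[OF less_imp_le[OF hk(3)]] by (simp add: coprime_iff_gcd_eq_1)
    moreover have "k - h < k" using hk by simp
    moreover have "1 - c = real (k - h) / real k" using k hk c by (simp add: of_nat_diff diff_divide_distrib)
    moreover have "- x \<notin> \<rat>" using irr by simp
    ultimately have "\<exists>Q. - x \<in> no_close_upper k Q"
      by (intro bdd_below_imp_no_close_upper[OF k])
    then obtain Q where "- x \<in> no_close_upper k Q" by blast
    then have "- (- x) \<in> uminus ` no_close_upper k Q" by (rule imageI)
    then show ?thesis by auto
  qed
  then show "x \<in> (\<Union>Q. no_close_upper k Q \<union> uminus ` no_close_upper k Q) - \<rat>" using irr by blast
qed

lemma bdd_below_in_one_side_bounded_set:
  "0 < x \<Longrightarrow> x \<notin> \<rat> \<Longrightarrow> bdd_below (range (discrepancy x c)) \<Longrightarrow> x \<in> one_side_bounded_set c"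
  by (simp add: one_side_bounded_set_def one_side_bounded_def)

section \<open>Topological consequences\<close>

lemma nowhere_dense_subset_closed_null:
  fixes E :: "real set"
  assumes "closed E" "E \<in> null_sets lebesgue" "S \<subseteq> E"
  shows "nowhere_dense S"
proof -
  have "interior (closure S) \<subseteq> E"
    using interior_subset closure_minimal[OF assms(3,1)] by blast
  then have "negligible (interior (closure S))"
    using assms(2) negligible_subset negligible_iff_null_sets by blast
  then show ?thesis
    unfolding nowhere_dense_def using open_interior open_not_negligible by blast
qed

lemma first_category_subset_UN:
  fixes E :: "nat \<Rightarrow> real set"
  assumes "S \<subseteq> (\<Union>i. E i)" "\<And>i. closed (E i)" "\<And>i. E i \<in> null_sets lebesgue"
  shows "first_category S"
  unfolding first_category_def
proof (intro exI conjI allI)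
  \<comment> \<open>The definition of \<open>first_category\<close> asks for equality with the
    union, so the closed sets are cut down to \<open>S\<close>.\<close>
  show "nowhere_dense (S \<inter> E i)" for i
    using nowhere_dense_subset_closed_null[OF assms(2,3)] by blast
  show "S = (\<Union>i. S \<inter> E i)" using assms(1) by blast
qed

lemma totally_disconnected_irrational:
  fixes S :: "real set"
  assumes "S \<inter> \<rat> = {}"
  shows "totally_disconnected S"
  unfolding totally_disconnected_def
proof (intro allI impI ballI)
  fix C and x y :: real assume C: "C \<subseteq> S \<and> connected C" and xy: "x \<in> C" "y \<in> C"
  have False if uv: "u \<in> C" "v \<in> C" "u < v" for u v
  proof -
    obtain q where q: "q \<in> \<rat>" "u < q" "q < v" using Rats_dense_in_real[OF uv(3)] by blast
    then have "q \<in> C" using connected_contains_Icc[of C u v] C uv by auto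
    then show False using q C assms by blast
  qed
  then show "x = y" using xy by (metis linorder_neqE_linordered_idom)
qed

theorem theorem1p3:
  fixes h k :: nat and c :: real
  assumes "h > 0" and "k > 0" and "coprime h k"
    and "c = real h / real k" and "0 < c" and "c < 1"
  shows "{0<..} \<subseteq> closure (one_side_bounded_set c)
    \<and> first_category (one_side_bounded_set c)
    \<and> 0 < hausdorff_dim (one_side_bounded_set c)
    \<and> hausdorff_dim (one_side_bounded_set c) < 1
    \<and> uncountable (one_side_bounded_set c)
    \<and> one_side_bounded_set c \<in> null_sets lebesgue
    \<and> totally_disconnected (one_side_bounded_set c)"
proof -
  let ?O = "one_side_bounded_set c"
  have hk: "h < k" using assms by (simp add: divide_less_eq)
  then have k: "2 \<le> k" using assms(1) by simp
  define E where "E = (\<lambda>Q. no_close_upper k Q \<union> uminus ` no_close_upper k Q)"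
  have sub: "?O \<subseteq> (\<Union>Q. E Q) - \<rat>"
    unfolding E_def using one_side_bounded_set_subset[OF assms(2,3,1) hk assms(4)] .
  obtain t where t: "0 < t" "t < 1" and null: "\<And>Q. hausdorff_premeasure t 1 (no_close_upper k Q - \<rat>) = 0"
    using no_close_upper_null[OF k] by blast
  \<comment> \<open>The cell argument treats irrational points only; the closed sets may contain
    rationals, which form a countable null set.\<close>
  have cQ: "hausdorff_premeasure t 1 (\<rat> :: real set) = 0"
    using t countable_rat by (intro hausdorff_premeasure_null_countable) auto
  have "hausdorff_premeasure t 1 (no_close_upper k Q) = 0" for Q
    using hausdorff_premeasure_null_Un[OF null[of Q] cQ]
      hausdorff_premeasure_mono[of "no_close_upper k Q" "no_close_upper k Q - \<rat> \<union> \<rat>" t 1]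
    by auto
  then have nullE: "hausdorff_premeasure t 1 (E Q) = 0" for Q
    unfolding E_def using t by (intro hausdorff_premeasure_null_Un hausdorff_premeasure_null_uminus) auto
  then have "hausdorff_premeasure t 1 (\<Union>Q. E Q) = 0"
    by (intro hausdorff_premeasure_null_UN) auto
  then have nullO: "hausdorff_premeasure t 1 ?O = 0"
    using hausdorff_premeasure_mono[of ?O "\<Union>Q. E Q" t 1] sub by auto
  have closedE: "closed (E Q)" for Q
    unfolding E_def using closed_no_close_upper by (intro closed_Un closed_negations) auto
  have nullL: "E Q \<in> null_sets lebesgue" for Q
    using hausdorff_premeasure_null_imp_null_sets[OF nullE] t by simp
  have cat: "first_category ?O"
    using sub by (intro first_category_subset_UN[of _ E] closedE nullL) auto
  have "hausdorff_dim ?O \<le> ennreal t"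
    unfolding hausdorff_dim_def
  proof (rule INF_lower)
    show "t \<in> {s. 0 \<le> s \<and> hausdorff_measure s ?O = 0}"
      using hausdorff_measure_eq_0[OF nullO] t by simp
  qed
  also have "\<dots> < 1" using t by (simp add: ennreal_less_one_iff)
  finally have dim1: "hausdorff_dim ?O < 1" .
  have heavy: "cf_heavy k (range (cantor_cf k))" by (rule cf_heavy_range_cantor_cf[OF k])
  have cantor_irr: "cantor_cf k y \<notin> \<rat>" for y
    using cf_heavy_irrational[OF assms(2) heavy] by blast
  have cantor_nonneg: "0 \<le> discrepancy (cantor_cf k y) c N" for y N
    using cf_heavy_discrepancy_nonneg[OF assms(2,4-6) heavy] by blast
  have "cantor_cf k y \<in> ?O" for y
    using cantor_cf_bounds(1)[OF k] cantor_irr cantor_nonneg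
    by (intro bdd_below_in_one_side_bounded_set) (auto intro!: bdd_belowI[of _ 0])
  then have "cantor_cf k ` {0..<1} \<subseteq> ?O" by blast
  then have "ennreal (ln 2 / ln ((2 * real k + 1)\<^sup>2)) \<le> hausdorff_dim ?O"
    using cantor_cf_inverse_Hoelder[OF k] by (intro hausdorff_dim_ge_inverse_Hoelder) auto
  moreover have "0 < ennreal (ln 2 / ln ((2 * real k + 1)\<^sup>2))"
    using cantor_cf_inverse_Hoelder(1)[OF k] by simp
  ultimately have dim0: "0 < hausdorff_dim ?O" by (rule less_le_trans[rotated])
  \<comment> \<open>Adding 1 leaves the discrepancy unchanged and moves the point above 1, as the
    Moebius maps require.\<close>
  define \<gamma> where "\<gamma> = cantor_cf k 0 + of_int 1"
  have \<gamma>: "1 < \<gamma>" "\<gamma> \<notin> \<rat>"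
  proof -
    show "1 < \<gamma>" using cantor_cf_bounds(1)[OF k] by (simp add: \<gamma>_def)
    show "\<gamma> \<notin> \<rat>"
    proof
      assume "\<gamma> \<in> \<rat>"
      then have "\<gamma> - 1 \<in> \<rat>" by (intro Rats_diff) auto
      then show False using cantor_irr[of 0] by (simp add: \<gamma>_def)
    qed
  qed
  have \<gamma>_nonneg: "0 \<le> discrepancy \<gamma> c X" for X
    unfolding \<gamma>_def discrepancy_add_int by (rule cantor_nonneg)
  have dense: "{0<..} \<subseteq> closure ?O"
  proof
    fix z :: real assume "z \<in> {0<..}"
    then have z: "0 < z" by simp
    have "\<exists>x\<in>?O. dist x z < e" if e: "0 < e" for e
    proof -
      \<comment> \<open>The bound by \<open>z\<close> keeps the approximating point
        positive.\<close>
      have "0 < min e z" using e z by simp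
      then obtain x where x: "\<bar>x - z\<bar> < min e z" "x \<notin> \<rat>" "bdd_below (range (discrepancy x c))"
        by (rule bdd_below_dense[OF k assms(4-6) \<gamma> \<gamma>_nonneg])
      then have "0 < x" "dist x z < e" by (auto simp: dist_real_def)
      then show ?thesis using bdd_below_in_one_side_bounded_set x(2,3) by blast
    qed
    then show "z \<in> closure ?O" by (simp add: closure_approachable)
  qed
  have "totally_disconnected ?O"
    by (rule totally_disconnected_irrational) (auto simp: one_side_bounded_set_def)
  moreover have "?O \<in> null_sets lebesgue"
    using hausdorff_premeasure_null_imp_null_sets[OF nullO] t by simp
  ultimately show ?thesis
    using dense cat dim0 dim1 uncountable_if_hausdorff_dim_pos[OF dim0] by blast
qed

end
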